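(* If $D$ is a decidable domain, then the canonical adjudicator $\chi_D$ is total computable and correct. Two instances are the following. (a) Presburger-conditioned distinctions: $D$ is indexed by the sentences $\phi$ of Presburger arithmetic, with $d_\phi\in\mathbf{M}_D\iff\mathbb{N}\models\phi$. This domain is decidable, and a decision procedure with certificates is obtained by the Büchi–Elgot automata method, the accepting or rejecting run of the automaton associated with $\phi$ serving as the witness. (b) Finite-state re-entry systems: systems of $n$ feedback equations over $\{\text{void},\text{mark}\}$ built from crossing and juxtaposition, observed at one coordinate. The state space has size $\leq 2^n$ and the evolution is deterministic, so the behaviour is ultimately periodic; the pair $(\mu,\pi)$ of transient and period is a certificate scheme: $p\notin\mathbf{M}_D$ if and only if the prefix-plus-cycle of length $\mu+\pi$ of the observed behaviour is mark-free, and $\mu+\pi\leq 2^n$ bounds the certificate effectively in the presentation.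
   Context: A domain is a set $D$ of distinctions (numbered by natural numbers, $D\subseteq\mathbb{N}$) together with a manifestation predicate $\mathbf{M}_D$ appropriate to its presentation. $D$ is decidable if the restricted manifestation problem $\{p\in D:p\in\mathbf{M}_D\}$ is decidable. The canonical adjudicator of $D$ is the function $\chi_D$ on $D$ with $\chi_D(p)=1$ iff $p\in D\setminus\mathbf{M}_D$ (and value $\ne 1$ otherwise). An adjudicator annuls $p$ if its value at $p$ is $1$; it is total if defined on all of $D$; a total adjudicator is correct for $D$ if it annuls exactly the members of $D$ not in $\mathbf{M}_D$. A certificate scheme for $D$ is a computable relation $C(p,w)$ between distinctions and finite objects such that $p\notin\mathbf{M}_D\iff\exists w\,C(p,w)$, with a computable witness function. Finite-state re-entry systems: over the two-element algebra $\{\text{void},\text{mark}\}=\{0,1\}$, crossing is negation and juxtaposition is disjunction. A system consists of $n$ state variables, each updated synchronously by an expression in the state variables built from crossing and juxtaposition (i.e. a synchronous Boolean network), evolving from its initial state, with one designated observed coordinate. The system manifests iff the observed coordinate takes the value mark at some time. The transient $\mu$ and period $\pi$ are those of the eventually periodic orbit of states. *)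

theory Defs
  imports "HOL-Library.Nat_Bijection"
begin

section \<open>Computability: Kleene's partial recursive functions\<close>

datatype recf =
    Zero_fn
  | Succ_fn
  | Proj_fn nat
  | Comp_fn recf "recf list"
  | Prim_fn recf recf
  | Min_fn recf

text \<open>
  \<open>None\<close> is divergence. In primitive recursion and in minimisation the recursion variable is the
  first argument; minimisation diverges if the function diverges before its first zero.
\<close>

fun run_recf :: "recf \<Rightarrow> nat list \<Rightarrow> nat option" where
  "run_recf Zero_fn xs = Some 0"
| "run_recf Succ_fn xs = (case xs of [] \<Rightarrow> None | x # _ \<Rightarrow> Some (Suc x))"
| "run_recf (Proj_fn i) xs = (if i < length xs then Some (xs ! i) else None)"
| "run_recf (Comp_fn f gs) xs =
     (if \<forall>g \<in> set gs. run_recf g xs \<noteq> None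
      then run_recf f (map (\<lambda>g. the (run_recf g xs)) gs) else None)"
| "run_recf (Prim_fn f g) xs =
     (case xs of [] \<Rightarrow> None
      | n # ys \<Rightarrow> rec_nat (run_recf f ys)
                  (\<lambda>m v. case v of None \<Rightarrow> None | Some u \<Rightarrow> run_recf g (m # u # ys)) n)"
| "run_recf (Min_fn f) xs =
     (if \<exists>n. run_recf f (n # xs) = Some 0 \<and> (\<forall>m<n. run_recf f (m # xs) \<noteq> None)
      then Some (LEAST n. run_recf f (n # xs) = Some 0) else None)"

definition decidable_set :: "nat set \<Rightarrow> bool" where
  "decidable_set A \<longleftrightarrow> (\<exists>r. \<forall>p. run_recf r [p] = Some (of_bool (p \<in> A)))"

text \<open>
  A function given on a set \<open>A\<close> of naturals is computable if it is the restriction to \<open>A\<close> of a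
  partial recursive function; likewise for relations between members of \<open>A\<close> and finite objects.
\<close>

definition computable_on :: "nat set \<Rightarrow> (nat \<Rightarrow> nat option) \<Rightarrow> bool" where
  "computable_on A f \<longleftrightarrow> (\<exists>r. \<forall>p \<in> A. run_recf r [p] = f p)"

definition computable_rel_on :: "nat set \<Rightarrow> (nat \<Rightarrow> nat \<Rightarrow> bool) \<Rightarrow> bool" where
  "computable_rel_on A C \<longleftrightarrow>
     (\<exists>r. \<forall>p \<in> A. \<forall>w. run_recf r [p, w] = Some (of_bool (C p w)))"


section \<open>Domains, adjudicators, certificates\<close>

record domain =
  distinctions :: "nat set"
  manifest :: "nat set"

definition decidable_domain :: "domain \<Rightarrow> bool" where
  "decidable_domain D \<longleftrightarrow> decidable_set {p \<in> distinctions D. p \<in> manifest D}"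

text \<open>Adjudicators are partial functions on the distinctions.\<close>

definition canonical_adjudicator :: "domain \<Rightarrow> nat \<Rightarrow> nat option" where
  "canonical_adjudicator D p =
     (if p \<in> distinctions D then Some (if p \<in> manifest D then 0 else 1) else None)"

definition annuls :: "(nat \<Rightarrow> nat option) \<Rightarrow> nat \<Rightarrow> bool" where
  "annuls A p \<longleftrightarrow> A p = Some 1"

definition total_adjudicator :: "domain \<Rightarrow> (nat \<Rightarrow> nat option) \<Rightarrow> bool" where
  "total_adjudicator D A \<longleftrightarrow> (\<forall>p \<in> distinctions D. A p \<noteq> None)"

definition correct_adjudicator :: "domain \<Rightarrow> (nat \<Rightarrow> nat option) \<Rightarrow> bool" where
  "correct_adjudicator D A \<longleftrightarrow>
     total_adjudicator D A \<and> {p. annuls A p} = distinctions D - manifest D"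

text \<open>Finite objects are given by their numeric codes.\<close>

definition certificate_scheme :: "domain \<Rightarrow> (nat \<Rightarrow> nat \<Rightarrow> bool) \<Rightarrow> bool" where
  "certificate_scheme D C \<longleftrightarrow>
     computable_rel_on (distinctions D) C \<and>
     (\<forall>p \<in> distinctions D. p \<notin> manifest D \<longleftrightarrow> (\<exists>w. C p w)) \<and>
     (\<exists>W. computable_on (distinctions D - manifest D) (\<lambda>p. Some (W p)) \<and>
          (\<forall>p \<in> distinctions D - manifest D. C p (W p)))"

text \<open>
  A decision procedure with certificates: \<open>Acc\<close> and \<open>Rej\<close> are the checkable certificates of
  manifestation and of its failure, and \<open>W\<close> computes one or the other for every distinction.
\<close>

definition certifying_decision ::
    "domain \<Rightarrow> (nat \<Rightarrow> nat \<Rightarrow> bool) \<Rightarrow> (nat \<Rightarrow> nat \<Rightarrow> bool) \<Rightarrow> bool" where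
  "certifying_decision D Acc Rej \<longleftrightarrow>
     computable_rel_on (distinctions D) Acc \<and>
     computable_rel_on (distinctions D) Rej \<and>
     (\<forall>p \<in> distinctions D. p \<in> manifest D \<longleftrightarrow> (\<exists>w. Acc p w)) \<and>
     (\<forall>p \<in> distinctions D. p \<notin> manifest D \<longleftrightarrow> (\<exists>w. Rej p w)) \<and>
     (\<exists>W. computable_on (distinctions D) (\<lambda>p. Some (W p)) \<and>
          (\<forall>p \<in> distinctions D. if p \<in> manifest D then Acc p (W p) else Rej p (W p)))"


section \<open>Presburger arithmetic\<close>

text \<open>First-order language of \<open>0, 1, +, =\<close> with named variables.\<close>

datatype tm = Zero | One | TVar nat | Add tm tm

datatype fm = Eq tm tm | Neg fm | Conj fm fm | Ex nat fm

primrec tm_vars :: "tm \<Rightarrow> nat set" where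
  "tm_vars Zero = {}"
| "tm_vars One = {}"
| "tm_vars (TVar x) = {x}"
| "tm_vars (Add s t) = tm_vars s \<union> tm_vars t"

primrec free_vars :: "fm \<Rightarrow> nat set" where
  "free_vars (Eq s t) = tm_vars s \<union> tm_vars t"
| "free_vars (Neg \<phi>) = free_vars \<phi>"
| "free_vars (Conj \<phi> \<psi>) = free_vars \<phi> \<union> free_vars \<psi>"
| "free_vars (Ex x \<phi>) = free_vars \<phi> - {x}"

definition sentence :: "fm \<Rightarrow> bool" where
  "sentence \<phi> \<longleftrightarrow> free_vars \<phi> = {}"

primrec tm_val :: "(nat \<Rightarrow> nat) \<Rightarrow> tm \<Rightarrow> nat" where
  "tm_val e Zero = 0"
| "tm_val e One = 1"
| "tm_val e (TVar x) = e x"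
| "tm_val e (Add s t) = tm_val e s + tm_val e t"

primrec sat :: "(nat \<Rightarrow> nat) \<Rightarrow> fm \<Rightarrow> bool" where
  "sat e (Eq s t) \<longleftrightarrow> tm_val e s = tm_val e t"
| "sat e (Neg \<phi>) \<longleftrightarrow> \<not> sat e \<phi>"
| "sat e (Conj \<phi> \<psi>) \<longleftrightarrow> sat e \<phi> \<and> sat e \<psi>"
| "sat e (Ex x \<phi>) \<longleftrightarrow> (\<exists>n. sat (e(x := n)) \<phi>)"

definition true_in_nat :: "fm \<Rightarrow> bool" where
  "true_in_nat \<phi> \<longleftrightarrow> (\<forall>e. sat e \<phi>)"

primrec tm_code :: "tm \<Rightarrow> nat" where
  "tm_code Zero = prod_encode (0, 0)"
| "tm_code One = prod_encode (1, 0)"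
| "tm_code (TVar x) = prod_encode (2, x)"
| "tm_code (Add s t) = prod_encode (3, prod_encode (tm_code s, tm_code t))"

primrec fm_code :: "fm \<Rightarrow> nat" where
  "fm_code (Eq s t) = prod_encode (0, prod_encode (tm_code s, tm_code t))"
| "fm_code (Neg \<phi>) = prod_encode (1, fm_code \<phi>)"
| "fm_code (Conj \<phi> \<psi>) = prod_encode (2, prod_encode (fm_code \<phi>, fm_code \<psi>))"
| "fm_code (Ex x \<phi>) = prod_encode (3, prod_encode (x, fm_code \<phi>))"

definition presburger_domain :: domain where
  "presburger_domain =
     \<lparr> distinctions = {fm_code \<phi> | \<phi>. sentence \<phi>},
       manifest = {fm_code \<phi> | \<phi>. sentence \<phi> \<and> true_in_nat \<phi>} \<rparr>"


section \<open>The automata method of Buechi and Elgot\<close>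

text \<open>
  Deterministic automata whose states are natural numbers. A word lists the binary digits of the
  values of all variables in parallel, least significant digits first; a letter is the set of those
  variables whose current digit is 1. Any word may be padded at its end with empty letters without
  changing the encoded values. The alphabet for a formula \<open>\<phi>\<close> is \<open>Pow (free_vars \<phi>)\<close>, which for
  a sentence has the empty letter as its only member.
\<close>

record dfa =
  dfa_states :: "nat set"
  dfa_init :: nat
  dfa_next :: "nat \<Rightarrow> nat set \<Rightarrow> nat"
  dfa_final :: "nat set"

definition finite_dfa :: "nat set \<Rightarrow> dfa \<Rightarrow> bool" where
  "finite_dfa V A \<longleftrightarrow>
     finite V \<and> finite (dfa_states A) \<and> dfa_init A \<in> dfa_states A \<and>
     dfa_final A \<subseteq> dfa_states A \<and>
     (\<forall>q \<in> dfa_states A. \<forall>a \<in> Pow V. dfa_next A q a \<in> dfa_states A)"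

fun run_from :: "dfa \<Rightarrow> nat \<Rightarrow> nat set list \<Rightarrow> nat list" where
  "run_from A q [] = [q]"
| "run_from A q (a # u) = q # run_from A (dfa_next A q a) u"

definition dfa_run :: "dfa \<Rightarrow> nat set list \<Rightarrow> nat list" where
  "dfa_run A u = run_from A (dfa_init A) u"

definition dfa_accepts :: "dfa \<Rightarrow> nat set list \<Rightarrow> bool" where
  "dfa_accepts A u \<longleftrightarrow> last (dfa_run A u) \<in> dfa_final A"

definition word_val :: "nat set list \<Rightarrow> nat \<Rightarrow> nat" where
  "word_val u x = (\<Sum>i<length u. if x \<in> u ! i then 2 ^ i else 0)"

primrec tm_const :: "tm \<Rightarrow> int" where
  "tm_const Zero = 0"
| "tm_const One = 1"
| "tm_const (TVar x) = 0"
| "tm_const (Add s t) = tm_const s + tm_const t"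

primrec tm_coeff :: "tm \<Rightarrow> nat \<Rightarrow> int" where
  "tm_coeff Zero y = 0"
| "tm_coeff One y = 0"
| "tm_coeff (TVar x) y = of_bool (x = y)"
| "tm_coeff (Add s t) y = tm_coeff s y + tm_coeff t y"

text \<open>
  An equation is brought to the form \<open>\<Sum>x. c x * x = r\<close>, where the current value of \<open>r\<close> gives the
  state \<open>Suc (int_encode r)\<close>. If \<open>d\<close> is the contribution of the digits read, the remaining digits
  have to solve the equation with right-hand side \<open>(r - d) div 2\<close>, unless \<open>r - d\<close> is odd; the state
  0 is the rejecting sink.
\<close>

definition eq_dfa :: "tm \<Rightarrow> tm \<Rightarrow> dfa" where
  "eq_dfa s t =
    (let V = tm_vars s \<union> tm_vars t;
         c = (\<lambda>x. tm_coeff s x - tm_coeff t x);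
         r0 = tm_const t - tm_const s;
         bound = \<bar>r0\<bar> + (\<Sum>x\<in>V. \<bar>c x\<bar>)
     in \<lparr> dfa_states = insert 0 ((\<lambda>r. Suc (int_encode r)) ` {- bound .. bound}),
          dfa_init = Suc (int_encode r0),
          dfa_next = (\<lambda>q a. case q of 0 \<Rightarrow> 0
             | Suc k \<Rightarrow> let r' = int_decode k - (\<Sum>x \<in> a \<inter> V. c x)
                        in if even r' then Suc (int_encode (r' div 2)) else 0),
          dfa_final = {Suc (int_encode 0)} \<rparr>)"

definition neg_dfa :: "dfa \<Rightarrow> dfa" where
  "neg_dfa A = A \<lparr> dfa_final := dfa_states A - dfa_final A \<rparr>"

definition conj_dfa :: "dfa \<Rightarrow> dfa \<Rightarrow> dfa" where
  "conj_dfa A B =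
     \<lparr> dfa_states = prod_encode ` (dfa_states A \<times> dfa_states B),
       dfa_init = prod_encode (dfa_init A, dfa_init B),
       dfa_next = (\<lambda>q a. case prod_decode q of
          (q1, q2) \<Rightarrow> prod_encode (dfa_next A q1 a, dfa_next B q2 a)),
       dfa_final = prod_encode ` (dfa_final A \<times> dfa_final B) \<rparr>"

text \<open>
  Projection of the variable \<open>x\<close>, made deterministic by the subset construction. The value of \<open>x\<close>
  may need more digits than those of the other variables, so a set of states is final if
  some member of it reaches a final state on a word in which only \<open>x\<close> has digits 1.
\<close>

definition ex_dfa :: "nat \<Rightarrow> dfa \<Rightarrow> dfa" where
  "ex_dfa x A =
     \<lparr> dfa_states = set_encode ` Pow (dfa_states A),
       dfa_init = set_encode {dfa_init A},
       dfa_next = (\<lambda>S a. set_encode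
          (\<Union>q \<in> set_decode S. {dfa_next A q (a - {x}), dfa_next A q (insert x a)})),
       dfa_final = set_encode ` {S. S \<subseteq> dfa_states A \<and>
          (\<exists>q \<in> S. \<exists>u \<in> lists {{}, {x}}. last (run_from A q u) \<in> dfa_final A)} \<rparr>"

primrec fm_dfa :: "fm \<Rightarrow> dfa" where
  "fm_dfa (Eq s t) = eq_dfa s t"
| "fm_dfa (Neg \<phi>) = neg_dfa (fm_dfa \<phi>)"
| "fm_dfa (Conj \<phi> \<psi>) = conj_dfa (fm_dfa \<phi>) (fm_dfa \<psi>)"
| "fm_dfa (Ex x \<phi>) = ex_dfa x (fm_dfa \<phi>)"

text \<open>The certificates: runs on any of the words over the one-letter alphabet of the sentence.\<close>

definition accepting_run :: "nat \<Rightarrow> nat \<Rightarrow> bool" where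
  "accepting_run p w \<longleftrightarrow>
     (\<exists>\<phi> u. sentence \<phi> \<and> p = fm_code \<phi> \<and> u \<in> lists (Pow (free_vars \<phi>)) \<and>
            w = list_encode (dfa_run (fm_dfa \<phi>) u) \<and> dfa_accepts (fm_dfa \<phi>) u)"

definition rejecting_run :: "nat \<Rightarrow> nat \<Rightarrow> bool" where
  "rejecting_run p w \<longleftrightarrow>
     (\<exists>\<phi> u. sentence \<phi> \<and> p = fm_code \<phi> \<and> u \<in> lists (Pow (free_vars \<phi>)) \<and>
            w = list_encode (dfa_run (fm_dfa \<phi>) u) \<and> \<not> dfa_accepts (fm_dfa \<phi>) u)"


section \<open>Finite-state re-entry systems\<close>

text \<open>\<open>True\<close> is the mark, \<open>False\<close> the void; \<open>Void\<close> is the empty juxtaposition.\<close>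

datatype expr = Void | SVar nat | Cross expr | Juxt expr expr

primrec expr_val :: "bool list \<Rightarrow> expr \<Rightarrow> bool" where
  "expr_val s Void = False"
| "expr_val s (SVar i) = s ! i"
| "expr_val s (Cross a) = (\<not> expr_val s a)"
| "expr_val s (Juxt a b) = (expr_val s a \<or> expr_val s b)"

primrec expr_vars :: "expr \<Rightarrow> nat set" where
  "expr_vars Void = {}"
| "expr_vars (SVar i) = {i}"
| "expr_vars (Cross a) = expr_vars a"
| "expr_vars (Juxt a b) = expr_vars a \<union> expr_vars b"

record system =
  updates :: "expr list"
  initial :: "bool list"
  observed :: nat

definition dimension :: "system \<Rightarrow> nat" where
  "dimension S = length (updates S)"

definition reentry_system :: "system \<Rightarrow> bool" where
  "reentry_system S \<longleftrightarrow>
     length (initial S) = dimension S \<and> observed S < dimension S \<and>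
     (\<forall>a \<in> set (updates S). expr_vars a \<subseteq> {..<dimension S})"

definition state_space :: "system \<Rightarrow> bool list set" where
  "state_space S = {s. length s = dimension S}"

definition step :: "system \<Rightarrow> bool list \<Rightarrow> bool list" where
  "step S s = map (expr_val s) (updates S)"

definition evolution :: "system \<Rightarrow> nat \<Rightarrow> bool list" where
  "evolution S t = (step S ^^ t) (initial S)"

definition behaviour :: "system \<Rightarrow> nat \<Rightarrow> bool" where
  "behaviour S t = evolution S t ! observed S"

definition system_manifests :: "system \<Rightarrow> bool" where
  "system_manifests S \<longleftrightarrow> (\<exists>t. behaviour S t)"

definition periodic_from :: "(nat \<Rightarrow> 'a) \<Rightarrow> nat \<Rightarrow> nat \<Rightarrow> bool" where
  "periodic_from f m k \<longleftrightarrow> k > 0 \<and> (\<forall>t\<ge>m. f (t + k) = f t)"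

definition transient :: "system \<Rightarrow> nat" where
  "transient S = (LEAST m. \<exists>k. periodic_from (evolution S) m k)"

definition period :: "system \<Rightarrow> nat" where
  "period S = (LEAST k. periodic_from (evolution S) (transient S) k)"

primrec expr_code :: "expr \<Rightarrow> nat" where
  "expr_code Void = prod_encode (0, 0)"
| "expr_code (SVar i) = prod_encode (1, i)"
| "expr_code (Cross a) = prod_encode (2, expr_code a)"
| "expr_code (Juxt a b) = prod_encode (3, prod_encode (expr_code a, expr_code b))"

definition system_code :: "system \<Rightarrow> nat" where
  "system_code S =
     prod_encode (list_encode (map expr_code (updates S)),
       prod_encode (list_encode (map of_bool (initial S)), observed S))"

definition reentry_domain :: domain where
  "reentry_domain =
     \<lparr> distinctions = {system_code S | S. reentry_system S},
       manifest = {system_code S | S. reentry_system S \<and> system_manifests S} \<rparr>"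

text \<open>The certificate is the code of the pair of transient and period.\<close>

definition mark_free_cycle :: "nat \<Rightarrow> nat \<Rightarrow> bool" where
  "mark_free_cycle p w \<longleftrightarrow>
     (\<exists>S. reentry_system S \<and> p = system_code S \<and> w = prod_encode (transient S, period S) \<and>
          (\<forall>t < transient S + period S. \<not> behaviour S t))"

end

theory Submission
  imports Defs
begin

text \<open>
  Apart from the witness functions, which search for the first certificate, everything that has to be
  computed is primitive recursive, by course-of-values recursion on codes.

  For Presburger arithmetic the subset construction is made effective by an explicit bound on the
  (numerically coded) states of the automaton of a formula. Below this bound the transition functions
  are tabulated by recursion on the formula, and so are the sets of final states: that a final state
  can be reached is expressed by a bounded quantification over sets of states closed under the
  relevant letters. On a sentence the only letter is the empty set, so the truth value is decided by
  the initial state alone and a run certifies it.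

  For re-entry systems no state repeats before time \<open>transient + period\<close>, hence this number
  is at most the number \<open>2 ^ n\<close> of states, and manifestation is decided by the
  states up to time \<open>2 ^ n\<close>.
\<close>

section \<open>Total recursive functions\<close>

text \<open>Decidability of a domain asks for a recursive function that answers on every natural
  number, so codes of sentences and of systems have to be recognised among all numbers; certificate
  relations only have to be right on genuine codes. The obstacle for formulas is that the automaton
  of \<open>Ex x \<phi>\<close> calls that of \<open>\<phi>\<close> at many states and letters,
  whereas course-of-values recursion with a fixed parameter delivers one number for each smaller
  code. Hence a transition function has to fit into one number, and the range of states and letters
  has to be known before the recursion starts. The bounds of the full sentence serve all its
  subformulas, because codes and state bounds do not decrease from a formula to one containing it.
  Transient and period are defined by conditions on all times; determinism turns these into a single
  return of the evolution, which can be checked.\<close>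

definition computable_args :: "nat \<Rightarrow> (nat list \<Rightarrow> nat) \<Rightarrow> bool" where
  "computable_args k f \<longleftrightarrow> (\<exists>r. \<forall>xs. length xs = k \<longrightarrow> run_recf r xs = Some (f xs))"

lemma computable_argsE:
  assumes "computable_args k f"
  obtains r where "\<And>xs. length xs = k \<Longrightarrow> run_recf r xs = Some (f xs)"
  using assms unfolding computable_args_def by blast

lemma computable_argsI:
  assumes "\<And>xs. length xs = k \<Longrightarrow> run_recf r xs = Some (f xs)"
  shows "computable_args k f"
  using assms unfolding computable_args_def by blast

lemma computable_args_nth: "i < k \<Longrightarrow> computable_args k (\<lambda>xs. xs ! i)"
  by (rule computable_argsI[where r = "Proj_fn i"]) simp

lemma computable_args_Suc:
  assumes "computable_args k f"
  shows "computable_args k (\<lambda>xs. Suc (f xs))"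
proof -
  obtain r where "\<And>xs. length xs = k \<Longrightarrow> run_recf r xs = Some (f xs)"
    using assms by (rule computable_argsE) blast
  then show ?thesis by (intro computable_argsI[where r = "Comp_fn Succ_fn [r]"]) simp
qed

lemma computable_args_const: "computable_args k (\<lambda>xs. c)"
proof (induction c)
  case 0
  show ?case by (rule computable_argsI[where r = Zero_fn]) simp
qed (rule computable_args_Suc)

lemma computable_args_comp1:
  assumes "computable_args 1 (\<lambda>ys. f (ys ! 0))" "computable_args k g"
  shows "computable_args k (\<lambda>xs. f (g xs))"
proof -
  obtain rf where rf: "\<And>ys. length ys = 1 \<Longrightarrow> run_recf rf ys = Some (f (ys ! 0))"
    using assms(1) by (rule computable_argsE) blast
  obtain rg where "\<And>xs. length xs = k \<Longrightarrow> run_recf rg xs = Some (g xs)"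
    using assms(2) by (rule computable_argsE) blast
  then show ?thesis
    by (intro computable_argsI[where r = "Comp_fn rf [rg]"]) (simp add: rf)
qed

lemma computable_args_comp2:
  assumes "computable_args 2 (\<lambda>ys. f (ys ! 0) (ys ! 1))" "computable_args k g" "computable_args k h"
  shows "computable_args k (\<lambda>xs. f (g xs) (h xs))"
proof -
  obtain rf where rf: "\<And>ys. length ys = 2 \<Longrightarrow> run_recf rf ys = Some (f (ys ! 0) (ys ! 1))"
    using assms(1) by (rule computable_argsE) blast
  obtain rg where rg: "\<And>xs. length xs = k \<Longrightarrow> run_recf rg xs = Some (g xs)"
    using assms(2) by (rule computable_argsE) blast
  obtain rh where "\<And>xs. length xs = k \<Longrightarrow> run_recf rh xs = Some (h xs)"
    using assms(3) by (rule computable_argsE) blast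
  then show ?thesis
    by (intro computable_argsI[where r = "Comp_fn rf [rg, rh]"]) (simp add: rf rg)
qed

text \<open>\<open>Prim_fn\<close> hands its step function the counter, the previous value and then
  the parameters, hence the indices 0, 1 and 2. One parameter is enough, because several values can
  be packed into it by pairing.\<close>

lemma computable_args_rec_nat:
  assumes "computable_args 1 (\<lambda>ys. b (ys ! 0))"
    and "computable_args 3 (\<lambda>ys. s (ys ! 2) (ys ! 0) (ys ! 1))"
    and "computable_args k n" "computable_args k g"
  shows "computable_args k (\<lambda>xs. rec_nat (b (g xs)) (s (g xs)) (n xs))"
proof -
  obtain rb where rb: "\<And>ys. length ys = 1 \<Longrightarrow> run_recf rb ys = Some (b (ys ! 0))"
    using assms(1) by (rule computable_argsE) blast
  obtain rs where rs: "\<And>ys. length ys = 3 \<Longrightarrow> run_recf rs ys = Some (s (ys ! 2) (ys ! 0) (ys ! 1))"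
    using assms(2) by (rule computable_argsE) blast
  have "run_recf (Prim_fn rb rs) [m, y] = Some (rec_nat (b y) (s y) m)" for m y
    by (induction m) (simp_all add: rb rs)
  then have "computable_args 2 (\<lambda>xs. rec_nat (b (xs ! 1)) (s (xs ! 1)) (xs ! 0))"
    by (intro computable_argsI[where r = "Prim_fn rb rs"]) (auto simp: length_Suc_conv numeral_2_eq_2)
  from computable_args_comp2[OF this assms(3,4)] show ?thesis .
qed

lemma computable_args_add:
  assumes "computable_args k f" "computable_args k g"
  shows "computable_args k (\<lambda>xs. f xs + g xs)"
proof -
  have "rec_nat y (\<lambda>m u. Suc u) x = x + y" for x y :: nat
    by (induction x) auto
  moreover have "computable_args k (\<lambda>xs. rec_nat (g xs) (\<lambda>m u. Suc u) (f xs))"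
    by (intro computable_args_rec_nat computable_args_Suc computable_args_nth assms) auto
  ultimately show ?thesis by simp
qed

lemma computable_args_pred:
  assumes "computable_args k f"
  shows "computable_args k (\<lambda>xs. f xs - 1)"
proof -
  have "rec_nat 0 (\<lambda>m u. m) x = x - 1" for x :: nat
    by (cases x) auto
  moreover have "computable_args k (\<lambda>xs. rec_nat 0 (\<lambda>m u. m) (f xs))"
    using computable_args_rec_nat[of "\<lambda>_. 0" "\<lambda>_ m _. m" k f f]
    by (simp add: computable_args_const computable_args_nth assms)
  ultimately show ?thesis by simp
qed

lemma computable_args_diff:
  assumes "computable_args k f" "computable_args k g"
  shows "computable_args k (\<lambda>xs. f xs - g xs)"
proof -
  have "rec_nat y (\<lambda>m u. u - 1) x = y - x" for x y :: nat
    by (induction x) auto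
  moreover have "computable_args k (\<lambda>xs. rec_nat (f xs) (\<lambda>m u. u - 1) (g xs))"
    by (intro computable_args_rec_nat computable_args_pred computable_args_nth assms) auto
  ultimately show ?thesis by simp
qed

lemma computable_args_mult:
  assumes "computable_args k f" "computable_args k g"
  shows "computable_args k (\<lambda>xs. f xs * g xs)"
proof -
  have "rec_nat 0 (\<lambda>m u. u + y) x = x * y" for x y :: nat
    by (induction x) auto
  moreover have "computable_args k (\<lambda>xs. rec_nat 0 (\<lambda>m u. u + g xs) (f xs))"
    by (intro computable_args_rec_nat[where b = "\<lambda>_. 0" and s = "\<lambda>y _ u. u + y"]
        computable_args_const computable_args_add computable_args_nth assms) auto
  ultimately show ?thesis by simp
qed

lemma computable_args_triangle:
  assumes "computable_args k f"
  shows "computable_args k (\<lambda>xs. triangle (f xs))"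
proof -
  have "rec_nat 0 (\<lambda>m u. u + Suc m) x = triangle x" for x :: nat
    by (induction x) auto
  moreover have "computable_args k (\<lambda>xs. rec_nat 0 (\<lambda>m u. u + Suc m) (f xs))"
    by (intro computable_args_rec_nat[where b = "\<lambda>_. 0" and s = "\<lambda>_ m u. u + Suc m" and g = f]
        computable_args_const computable_args_add computable_args_Suc computable_args_nth assms) auto
  ultimately show ?thesis by simp
qed

lemma computable_args_prod_encode:
  assumes "computable_args k f" "computable_args k g"
  shows "computable_args k (\<lambda>xs. prod_encode (f xs, g xs))"
  unfolding prod_encode_def using assms
  by (simp add: computable_args_add computable_args_triangle)

section \<open>Inverting the Cantor pairing function\<close>

definition pfst :: "nat \<Rightarrow> nat" where "pfst z = fst (prod_decode z)"

definition psnd :: "nat \<Rightarrow> nat" where "psnd z = snd (prod_decode z)"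

lemma pfst_prod_encode [simp]: "pfst (prod_encode (a, b)) = a"
  by (simp add: pfst_def)

lemma psnd_prod_encode [simp]: "psnd (prod_encode (a, b)) = b"
  by (simp add: psnd_def)

lemma prod_encode_pfst_psnd [simp]: "prod_encode (pfst z, psnd z) = z"
  by (simp add: pfst_def psnd_def)

lemma prod_encode_eq_iff: "z = prod_encode (a, b) \<longleftrightarrow> pfst z = a \<and> psnd z = b"
  by (metis pfst_prod_encode psnd_prod_encode prod_encode_pfst_psnd)

lemma add_le_prod_encode: "a + b \<le> prod_encode (a, b)"
proof -
  have "n \<le> triangle n" for n by (induction n) auto
  then show ?thesis by (simp add: prod_encode_def trans_le_add1)
qed

lemma pfst_le: "pfst z \<le> z" and psnd_le: "psnd z \<le> z"
  using add_le_prod_encode[of "pfst z" "psnd z"] by auto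

text \<open>The index of the antidiagonal on which the pair coded by \<open>z\<close> lies, that is
  the largest \<open>d\<close> with \<open>triangle d \<le> z\<close>. The truncated difference is 1
  exactly if \<open>Suc m\<close> has reached the next triangular number, so the index advances by
  at most one per step.\<close>

definition diagonal :: "nat \<Rightarrow> nat" where
  "diagonal z = rec_nat 0 (\<lambda>m u. u + (1 - (triangle (Suc u) - Suc m))) z"

lemma diagonal_bounds: "triangle (diagonal z) \<le> z \<and> z < triangle (Suc (diagonal z))"
proof (induction z)
  case (Suc z)
  define u where "u = diagonal z"
  have "diagonal (Suc z) = u + (1 - (triangle (Suc u) - Suc z))"
    by (simp add: diagonal_def u_def)
  then show ?case using Suc unfolding u_def[symmetric] by (cases "triangle (Suc u) \<le> Suc z") auto
qed (simp add: diagonal_def)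

lemma triangle_mono: "m \<le> n \<Longrightarrow> triangle m \<le> triangle n"
  by (induction rule: dec_induct) auto

text \<open>A number lies between consecutive triangular numbers in only one way, and both
  \<open>diagonal z\<close> and the sum of the components index such an interval. The components
  thereby become computable by subtraction.\<close>

lemma diagonal_eq: "diagonal z = pfst z + psnd z"
proof -
  let ?s = "pfst z + psnd z"
  have z: "z = triangle ?s + pfst z"
    using prod_encode_pfst_psnd[of z] unfolding prod_encode_def by simp
  have "triangle ?s \<le> z" "z < triangle (Suc ?s)"
    by (subst z, simp)+
  moreover note diagonal_bounds[of z]
  ultimately show ?thesis
    using triangle_mono[of "Suc ?s" "diagonal z"] triangle_mono[of "Suc (diagonal z)" ?s]
    by (metis le_antisym leI le_trans not_less not_less_eq_eq)
qed

lemma pfst_eq_diagonal: "pfst z = z - triangle (diagonal z)"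
  using prod_encode_pfst_psnd[of z] unfolding diagonal_eq prod_encode_def by simp

lemma psnd_eq_diagonal: "psnd z = diagonal z - pfst z"
  by (simp add: diagonal_eq)

lemma computable_args_diagonal:
  assumes "computable_args k f"
  shows "computable_args k (\<lambda>xs. diagonal (f xs))"
  unfolding diagonal_def
  by (intro computable_args_rec_nat[where b = "\<lambda>_. 0"
        and s = "\<lambda>_ m u. u + (1 - (triangle (Suc u) - Suc m))" and g = f]
      computable_args_const computable_args_add computable_args_diff computable_args_triangle
      computable_args_Suc computable_args_nth assms) auto

text \<open>
  From here on all functions are unary: several arguments are passed as nested pairs, so that an
  intro rule can bind a further variable by pairing it with the old argument.
\<close>

definition computable :: "(nat \<Rightarrow> nat) \<Rightarrow> bool" where
  "computable f \<longleftrightarrow> computable_args 1 (\<lambda>xs. f (xs ! 0))"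

abbreviation decidable_pred :: "(nat \<Rightarrow> bool) \<Rightarrow> bool" where
  "decidable_pred P \<equiv> computable (\<lambda>x. of_bool (P x))"

named_theorems computable_intro

lemma computable_iff: "computable f \<longleftrightarrow> (\<exists>r. \<forall>x. run_recf r [x] = Some (f x))"
proof
  assume "\<exists>r. \<forall>x. run_recf r [x] = Some (f x)"
  then obtain r where "\<And>x. run_recf r [x] = Some (f x)" by blast
  then show "computable f"
    unfolding computable_def by (intro computable_argsI[where r = r]) (auto simp: length_Suc_conv)
next
  assume "computable f"
  then obtain r where "\<And>xs. length xs = 1 \<Longrightarrow> run_recf r xs = Some (f (xs ! 0))"
    unfolding computable_def by (rule computable_argsE) blast
  then have "\<forall>x. run_recf r [x] = Some (f x)" by simp
  then show "\<exists>r. \<forall>x. run_recf r [x] = Some (f x)" ..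
qed

lemma computable_comp: "computable f \<Longrightarrow> computable g \<Longrightarrow> computable (\<lambda>x. f (g x))"
  unfolding computable_def by (rule computable_args_comp1)

lemma computable_id [computable_intro]: "computable (\<lambda>x. x)"
  unfolding computable_def by (rule computable_args_nth) simp

lemma computable_const [computable_intro]: "computable (\<lambda>x. c)"
  unfolding computable_def by (rule computable_args_const)

lemma computable_pfst [computable_intro]: "computable f \<Longrightarrow> computable (\<lambda>x. pfst (f x))"
  unfolding computable_def pfst_eq_diagonal
  by (intro computable_args_diff computable_args_triangle computable_args_diagonal)

lemma computable_psnd [computable_intro]: "computable f \<Longrightarrow> computable (\<lambda>x. psnd (f x))"
  unfolding computable_def psnd_eq_diagonal pfst_eq_diagonal
  by (intro computable_args_diff computable_args_triangle computable_args_diagonal)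

lemma computable_Suc [computable_intro]: "computable f \<Longrightarrow> computable (\<lambda>x. Suc (f x))"
  unfolding computable_def by (rule computable_args_Suc)

lemma computable_add [computable_intro]:
  "computable f \<Longrightarrow> computable g \<Longrightarrow> computable (\<lambda>x. f x + g x)"
  unfolding computable_def by (rule computable_args_add)

lemma computable_diff [computable_intro]:
  "computable f \<Longrightarrow> computable g \<Longrightarrow> computable (\<lambda>x. f x - g x)"
  unfolding computable_def by (rule computable_args_diff)

lemma computable_mult [computable_intro]:
  "computable f \<Longrightarrow> computable g \<Longrightarrow> computable (\<lambda>x. f x * g x)"
  unfolding computable_def by (rule computable_args_mult)

lemma computable_prod_encode [computable_intro]:
  "computable f \<Longrightarrow> computable g \<Longrightarrow> computable (\<lambda>x. prod_encode (f x, g x))"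
  unfolding computable_def by (rule computable_args_prod_encode)

text \<open>Lets an intro rule leave a binder: the hypothesis knows \<open>F\<close> at the two
  projections of one argument, while the goal has \<open>F\<close> at arbitrary computable
  terms.\<close>

lemma computable_comp2:
  assumes "computable (\<lambda>z. F (pfst z) (psnd z))" "computable f" "computable g"
  shows "computable (\<lambda>x. F (f x) (g x))"
  using computable_comp[OF assms(1) computable_prod_encode[OF assms(2,3)]] by simp

lemma computable_rec_nat [computable_intro]:
  assumes "computable b"
    and "computable (\<lambda>z. s (pfst z) (pfst (psnd z)) (psnd (psnd z)))"
    and "computable n"
  shows "computable (\<lambda>x. rec_nat (b x) (s x) (n x))"
  unfolding computable_def
\<comment> \<open>The whole argument is the parameter of the recursion, so that \<open>b\<close> and
  \<open>s\<close> may depend on it in any way.\<close>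
proof (rule computable_args_rec_nat[where g = "\<lambda>xs. xs ! 0"])
  show "computable_args 1 (\<lambda>ys. b (ys ! 0))" "computable_args 1 (\<lambda>xs. n (xs ! 0))"
    "computable_args 1 (\<lambda>xs. xs ! 0)"
    using assms by (auto simp: computable_def computable_args_nth)
  have "computable_args 3 (\<lambda>ys. prod_encode (ys ! 2, prod_encode (ys ! 0, ys ! 1)))"
    by (intro computable_args_prod_encode computable_args_nth) auto
  from computable_args_comp1[OF assms(2)[unfolded computable_def] this]
  show "computable_args 3 (\<lambda>ys. s (ys ! 2) (ys ! 0) (ys ! 1))" by simp
qed

section \<open>Bounded sums, arithmetic and bounded quantifiers\<close>

lemma computable_sum [computable_intro]:
  assumes "computable (\<lambda>z. F (pfst z) (psnd z))" "computable n"
  shows "computable (\<lambda>x. \<Sum>i<n x. F x i)"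
proof -
  have "rec_nat 0 (\<lambda>i u. u + h i) m = (\<Sum>i<m. h i)" for h :: "nat \<Rightarrow> nat" and m :: nat
    by (induction m) auto
  moreover have "computable (\<lambda>x. rec_nat 0 (\<lambda>i u. u + F x i) (n x))"
    by (intro computable_intro assms computable_comp2[of F])
  ultimately show ?thesis by simp
qed

lemma computable_power [computable_intro]:
  assumes "computable f" "computable g"
  shows "computable (\<lambda>x. f x ^ g x)"
proof -
  have "rec_nat 1 (\<lambda>i u. u * a) m = a ^ m" for a m :: nat
    by (induction m) auto
  moreover have "computable (\<lambda>x. rec_nat 1 (\<lambda>i u. u * f x) (g x))"
    by (intro computable_intro assms computable_comp[of f])
  ultimately show ?thesis by simp
qed

lemma computable_le [computable_intro]:
  assumes "computable f" "computable g"
  shows "decidable_pred (\<lambda>x. f x \<le> g x)"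
proof -
  have "of_bool (a \<le> b) = 1 - (a - b)" for a b :: nat by simp
  then show ?thesis by (simp only:) (intro computable_intro assms)
qed

lemma computable_less [computable_intro]:
  assumes "computable f" "computable g"
  shows "decidable_pred (\<lambda>x. f x < g x)"
  unfolding less_eq_Suc_le by (intro computable_intro assms)

lemma computable_not [computable_intro]:
  assumes "decidable_pred P"
  shows "decidable_pred (\<lambda>x. \<not> P x)"
proof -
  have "of_bool (\<not> Q) = (1 - of_bool Q :: nat)" for Q by simp
  then show ?thesis by (simp only:) (intro computable_intro assms)
qed

lemma computable_conj [computable_intro]:
  assumes "decidable_pred P" "decidable_pred Q"
  shows "decidable_pred (\<lambda>x. P x \<and> Q x)"
  unfolding of_bool_conj by (intro computable_intro assms)

lemma computable_disj [computable_intro]: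
  assumes "decidable_pred P" "decidable_pred Q"
  shows "decidable_pred (\<lambda>x. P x \<or> Q x)"
proof -
  have "decidable_pred (\<lambda>x. \<not> (\<not> P x \<and> \<not> Q x))" by (intro computable_intro assms)
  then show ?thesis by simp
qed

lemma computable_imp [computable_intro]:
  assumes "decidable_pred P" "decidable_pred Q"
  shows "decidable_pred (\<lambda>x. P x \<longrightarrow> Q x)"
  unfolding imp_conv_disj by (intro computable_intro assms)

lemma computable_eq [computable_intro]:
  assumes "computable f" "computable g"
  shows "decidable_pred (\<lambda>x. f x = g x)"
  unfolding order_eq_iff by (intro computable_intro assms)

lemma computable_if [computable_intro]:
  assumes "decidable_pred P" "computable f" "computable g"
  shows "computable (\<lambda>x. if P x then f x else g x)"
proof -
  have "computable (\<lambda>x. of_bool (P x) * f x + (1 - of_bool (P x)) * g x)"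
    by (intro computable_intro assms)
  moreover have "(if Q then a else b) = of_bool Q * a + (1 - of_bool Q) * b" for Q and a b :: nat
    by simp
  ultimately show ?thesis by (simp only:)
qed

lemma computable_ex_less [computable_intro]:
  assumes "decidable_pred (\<lambda>z. P (pfst z) (psnd z))" "computable n"
  shows "decidable_pred (\<lambda>x. \<exists>i<n x. P x i)"
proof -
  have "decidable_pred (\<lambda>x. 0 < (\<Sum>i<n x. of_bool (P x i) :: nat))"
    by (intro computable_intro assms)
  moreover have "0 < (\<Sum>i<m. of_bool (Q i) :: nat) \<longleftrightarrow> (\<exists>i<m. Q i)" for Q and m :: nat
    by (auto simp: zero_less_iff_neq_zero)
  ultimately show ?thesis by simp
qed

lemma computable_all_less [computable_intro]:
  assumes "decidable_pred (\<lambda>z. P (pfst z) (psnd z))" "computable n"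
  shows "decidable_pred (\<lambda>x. \<forall>i<n x. P x i)"
proof -
  have "decidable_pred (\<lambda>x. \<not> (\<exists>i<n x. \<not> P x i))"
    by (intro computable_intro assms)
  then show ?thesis by simp
qed

text \<open>The quotient counts the positive multiples of \<open>g x\<close> up to
  \<open>f x\<close>, of which there are at most \<open>f x\<close>. For the divisor 0 every index
  would be counted, so this case is set to the conventional value 0.\<close>

lemma computable_div [computable_intro]:
  assumes "computable f" "computable g"
  shows "computable (\<lambda>x. f x div g x)"
proof -
  have "computable (\<lambda>x. if g x = 0 then 0 else \<Sum>i<f x. of_bool (Suc i * g x \<le> f x))"
    by (intro computable_intro assms computable_comp[of f] computable_comp[of g])
  moreover have "(if b = 0 then 0 else \<Sum>i<a. of_bool (Suc i * b \<le> a)) = a div b" for a b :: nat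
  proof (cases "b = 0")
    case False
    then have "{..<a} \<inter> {i. Suc i * b \<le> a} = {..<a div b}"
      by (auto simp: less_eq_div_iff_mult_less_eq simp del: mult_Suc simp flip: Suc_le_eq)
        (metis Suc_leI dual_order.trans mult.right_neutral mult_le_mono2 neq0_conv One_nat_def)
    with False show ?thesis by (simp del: mult_Suc)
  qed simp
  ultimately show ?thesis by (simp only:)
qed

lemma computable_even [computable_intro]:
  assumes "computable f"
  shows "decidable_pred (\<lambda>x. even (f x))"
proof -
  have "decidable_pred (\<lambda>x. 2 * (f x div 2) = f x)" by (intro computable_intro assms)
  moreover have "2 * (a div 2) = a \<longleftrightarrow> even a" for a :: nat by presburger
  ultimately show ?thesis by (simp only:)
qed

lemma computable_set_decode [computable_intro]:
  assumes "computable f" "computable g"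
  shows "decidable_pred (\<lambda>x. f x \<in> set_decode (g x))"
  unfolding set_decode_def mem_Collect_eq by (intro computable_intro assms)

lemma computable_set_encode [computable_intro]:
  assumes "decidable_pred (\<lambda>z. P (pfst z) (psnd z))" "computable n"
  shows "computable (\<lambda>x. set_encode {i. i < n x \<and> P x i})"
proof -
  have "computable (\<lambda>x. \<Sum>i<n x. of_bool (P x i) * 2 ^ i)"
    by (intro computable_intro assms)
  moreover have "(\<Sum>i<m. of_bool (Q i) * 2 ^ i) = set_encode {i. i < m \<and> Q i}" for Q and m :: nat
    unfolding set_encode_def by (rule sum.mono_neutral_cong_right) auto
  ultimately show ?thesis by (simp only:)
qed

subsection \<open>Course-of-values recursion\<close>

text \<open>The newest value comes first, so that one pairing extends the table; an entry is found
  by stripping the newer ones.\<close>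

primrec table :: "(nat \<Rightarrow> nat) \<Rightarrow> nat \<Rightarrow> nat" where
  "table f 0 = 0"
| "table f (Suc n) = prod_encode (f n, table f n)"

text \<open>A table does not record its length \<open>n\<close>, which has to be supplied again for a lookup.\<close>

definition lookup :: "nat \<Rightarrow> nat \<Rightarrow> nat \<Rightarrow> nat" where
  "lookup n t i = pfst (rec_nat t (\<lambda>_. psnd) (n - Suc i))"

lemma lookup_table:
  assumes "i < n"
  shows "lookup n (table f n) i = f i"
proof -
  have "rec_nat (table f (m + k)) (\<lambda>_. psnd) k = table f m" for m k
    by (induction k arbitrary: m) (simp, metis add_Suc_shift old.nat.simps(7) psnd_prod_encode table.simps(2))
  from this[of "Suc i" "n - Suc i"] show ?thesis
    using assms by (simp add: lookup_def)
qed

lemma computable_lookup [computable_intro]: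
  assumes "computable n" "computable t" "computable i"
  shows "computable (\<lambda>x. lookup (n x) (t x) (i x))"
  unfolding lookup_def by (intro computable_intro assms)

text \<open>
  In \<open>course G p x\<close> the recursion is on \<open>x\<close>, and \<open>p\<close> is a parameter; \<open>G\<close> receives the table of the
  values at the numbers below \<open>x\<close>.
\<close>

primrec course_table :: "(nat \<Rightarrow> nat \<Rightarrow> nat \<Rightarrow> nat) \<Rightarrow> nat \<Rightarrow> nat \<Rightarrow> nat" where
  "course_table G p 0 = 0"
| "course_table G p (Suc n) = prod_encode (G p n (course_table G p n), course_table G p n)"

definition course :: "(nat \<Rightarrow> nat \<Rightarrow> nat \<Rightarrow> nat) \<Rightarrow> nat \<Rightarrow> nat \<Rightarrow> nat" where
  "course G p x = G p x (course_table G p x)"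

lemma lookup_course_table: "y < x \<Longrightarrow> lookup x (course_table G p x) y = course G p y"
proof -
  have "course_table G p x = table (course G p) x" for x
    by (induction x) (simp_all add: course_def)
  then show "y < x \<Longrightarrow> ?thesis" by (simp add: lookup_table)
qed

lemma computable_course:
  assumes G: "computable (\<lambda>z. G (pfst z) (pfst (psnd z)) (psnd (psnd z)))"
    and "computable p" "computable n"
  shows "computable (\<lambda>x. course G (p x) (n x))"
proof -
  have G': "computable (\<lambda>x. G (f x) (g x) (h x))"
    if "computable f" "computable g" "computable h" for f g h
    using computable_comp[OF G, of "\<lambda>x. prod_encode (f x, prod_encode (g x, h x))"]
    by (simp add: that computable_prod_encode)
  have "course_table G q m = rec_nat 0 (\<lambda>i u. prod_encode (G q i u, u)) m" for q m
    by (induction m) auto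
  then show ?thesis unfolding course_def
    by (simp only:) (intro computable_intro G' assms(2,3) computable_comp[of p])
qed

lemma computable_table [computable_intro]:
  assumes "computable (\<lambda>z. F (pfst z) (psnd z))" "computable n"
  shows "computable (\<lambda>x. table (F x) (n x))"
proof -
  have "table f m = rec_nat 0 (\<lambda>i u. prod_encode (f i, u)) m" for f m
    by (induction m) auto
  then show ?thesis
    by (simp only:) (intro computable_intro assms computable_comp2[of F])
qed

text \<open>For functions with a meaning of their own, such as the test for being the code of a
  formula: it is enough that they satisfy a course-of-values equation with their own table.
  \<open>course\<close> serves functions that are introduced by such a recursion.\<close>

lemma computable_courseI:
  assumes "computable (\<lambda>z. G (pfst z) (pfst (psnd z)) (psnd (psnd z)))"
    and f: "\<And>p x. f p x = G p x (table (f p) x)"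
    and "computable p" "computable n"
  shows "computable (\<lambda>x. f (p x) (n x))"
proof -
  have "course_table G p x = table (f p) x" for p x
    by (induction x) (simp_all add: f[symmetric])
  then have "f = course G" by (simp add: course_def f[symmetric] fun_eq_iff)
  then show ?thesis using computable_course[OF assms(1,3,4)] by simp
qed


subsection \<open>Lists\<close>

text \<open>Head and code of the tail are the components of \<open>l - 1\<close>, so the tail has a
  smaller code and functions on lists fall under course-of-values recursion.\<close>

lemma list_decode_unfold:
  "list_decode l = (if l = 0 then [] else pfst (l - 1) # list_decode (psnd (l - 1)))"
  by (cases l) (simp_all add: pfst_def psnd_def case_prod_beta)

lemma psnd_pred_less: "l \<noteq> 0 \<Longrightarrow> psnd (l - 1) < l"
  using psnd_le[of "l - 1"] by linarith

lemma computable_length [computable_intro]: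
  assumes "computable l"
  shows "computable (\<lambda>x. length (list_decode (l x)))"
proof (rule computable_courseI[where f = "\<lambda>_ x. length (list_decode x)" and p = "\<lambda>_. 0"
      and G = "\<lambda>_ x t. if x = 0 then 0 else Suc (lookup x t (psnd (x - 1)))"])
  show "length (list_decode x) =
      (if x = 0 then 0 else Suc (lookup x (table (\<lambda>x. length (list_decode x)) x) (psnd (x - 1))))"
    for x by (subst list_decode_unfold) (simp add: lookup_table psnd_pred_less del: One_nat_def)
qed (intro computable_intro assms)+

lemma computable_map [computable_intro]:
  assumes F: "computable (\<lambda>z. F (pfst z) (psnd z))" and "computable l"
  shows "computable (\<lambda>x. list_encode (map (F x) (list_decode (l x))))"
proof (rule computable_courseI[where f = "\<lambda>p x. list_encode (map (F p) (list_decode x))"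
      and p = "\<lambda>x. x"
      and G = "\<lambda>p x t. if x = 0 then 0
        else Suc (prod_encode (F p (pfst (x - 1)), lookup x t (psnd (x - 1))))"])
  show "list_encode (map (F p) (list_decode x)) = (if x = 0 then 0
      else Suc (prod_encode (F p (pfst (x - 1)),
        lookup x (table (\<lambda>x. list_encode (map (F p) (list_decode x))) x) (psnd (x - 1)))))" for p x
    by (subst list_decode_unfold) (simp add: lookup_table psnd_pred_less del: One_nat_def)
qed (intro computable_intro assms computable_comp2[of F])+

definition code_nth :: "nat \<Rightarrow> nat \<Rightarrow> nat" where
  "code_nth l i = pfst (rec_nat l (\<lambda>_ z. psnd (z - 1)) i - 1)"

lemma code_nth_list_encode: "i < length xs \<Longrightarrow> code_nth (list_encode xs) i = xs ! i"
proof -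
  have "rec_nat (list_encode xs) (\<lambda>_ z. psnd (z - 1)) i = list_encode (drop i xs)"
    if "i \<le> length xs" for i
    using that
  proof (induction i)
    case (Suc i)
    then have "drop i xs = xs ! i # drop (Suc i) xs" by (simp add: Cons_nth_drop_Suc)
    with Suc show ?case by simp
  qed simp
  moreover assume "i < length xs"
  ultimately show ?thesis by (simp add: code_nth_def flip: Cons_nth_drop_Suc)
qed

lemma computable_code_nth [computable_intro]:
  assumes "computable l" "computable i"
  shows "computable (\<lambda>x. code_nth (l x) (i x))"
  unfolding code_nth_def by (intro computable_intro assms)


subsection \<open>Decidable sets, relations and witness functions\<close>

lemma decidable_set_iff: "decidable_set A \<longleftrightarrow> decidable_pred (\<lambda>p. p \<in> A)"
  by (simp add: decidable_set_def computable_iff)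

lemma computable_onI:
  assumes "computable f" "\<And>p. p \<in> A \<Longrightarrow> g p = Some (f p)"
  shows "computable_on A g"
  using assms unfolding computable_on_def computable_iff by metis

lemma computable_args_uncurry:
  assumes "computable (\<lambda>z. F (pfst z) (psnd z))" "i < k" "j < k"
  shows "computable_args k (\<lambda>xs. F (xs ! i) (xs ! j))"
proof -
  have "computable_args k (\<lambda>xs. prod_encode (xs ! i, xs ! j))"
    by (intro computable_args_prod_encode computable_args_nth assms)
  from computable_args_comp1[OF assms(1)[unfolded computable_def] this] show ?thesis by simp
qed

lemma computable_rel_onI:
  assumes "decidable_pred (\<lambda>z. Q (pfst z) (psnd z))" "\<And>p w. p \<in> A \<Longrightarrow> C p w \<longleftrightarrow> Q p w"
  shows "computable_rel_on A C"
proof -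
  have "computable_args 2 (\<lambda>xs. of_bool (Q (xs ! 0) (xs ! 1)))"
    using assms(1) by (rule computable_args_uncurry[of "\<lambda>p w. of_bool (Q p w)"]) auto
  then obtain r where
    "\<And>xs. length xs = 2 \<Longrightarrow> run_recf r xs = Some (of_bool (Q (xs ! 0) (xs ! 1)))"
    by (rule computable_argsE) blast
  then have "run_recf r [p, w] = Some (of_bool (C p w))" if "p \<in> A" for p w
    using assms(2) that by simp
  then show ?thesis unfolding computable_rel_on_def by blast
qed

text \<open>Minimisation terminates where a witness exists, which is all that
  \<open>computable_on A\<close> asks; outside \<open>A\<close> it may diverge.\<close>

lemma computable_on_search:
  assumes "decidable_pred (\<lambda>z. Q (pfst z) (psnd z))" "\<And>p. p \<in> A \<Longrightarrow> \<exists>w. Q p w"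
  obtains W where "computable_on A (\<lambda>p. Some (W p))" "\<And>p. p \<in> A \<Longrightarrow> Q p (W p)"
proof
  \<comment> \<open>\<open>Min_fn\<close> searches in its first argument for the value 0: hence the
    negated predicate with its arguments exchanged.\<close>
  have "decidable_pred (\<lambda>z. \<not> Q (pfst z) (psnd z))"
    using assms(1) by (intro computable_intro)
  then have "computable_args 2 (\<lambda>xs. of_bool (\<not> Q (xs ! 1) (xs ! 0)))"
    by (rule computable_args_uncurry[of "\<lambda>p w. of_bool (\<not> Q p w)"]) auto
  then obtain r where
    r: "\<And>xs. length xs = 2 \<Longrightarrow> run_recf r xs = Some (of_bool (\<not> Q (xs ! 1) (xs ! 0)))"
    by (rule computable_argsE) blast
  have "run_recf (Min_fn r) [p] = Some (LEAST w. Q p w)" if "p \<in> A" for p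
    using assms(2)[OF that] by (auto simp: r)
  then show "computable_on A (\<lambda>p. Some (LEAST w. Q p w))"
    unfolding computable_on_def by blast
  show "p \<in> A \<Longrightarrow> Q p (LEAST w. Q p w)" for p
    using LeastI_ex[OF assms(2)] .
qed

text \<open>The witness function is the search for the first certificate, so a decidable relation
  with the right existence property is already a scheme.\<close>

lemma certificate_schemeI:
  assumes "decidable_pred (\<lambda>z. Q (pfst z) (psnd z))"
    and "\<And>p w. p \<in> distinctions D \<Longrightarrow> C p w \<longleftrightarrow> Q p w"
    and "\<And>p. p \<in> distinctions D \<Longrightarrow> p \<notin> manifest D \<longleftrightarrow> (\<exists>w. C p w)"
  shows "certificate_scheme D C"
proof -
  have "\<exists>w. Q p w" if "p \<in> distinctions D - manifest D" for p
    using assms(2,3) that by auto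
  then obtain W where "computable_on (distinctions D - manifest D) (\<lambda>p. Some (W p))"
    "\<And>p. p \<in> distinctions D - manifest D \<Longrightarrow> Q p (W p)"
    using computable_on_search[OF assms(1), of "distinctions D - manifest D"] by blast
  then show ?thesis
    unfolding certificate_scheme_def using computable_rel_onI[OF assms(1,2)] assms(2,3) by auto
qed

lemma canonical_adjudicator_correct: "correct_adjudicator D (canonical_adjudicator D)"
  by (auto simp: correct_adjudicator_def total_adjudicator_def annuls_def
      canonical_adjudicator_def split: if_splits)

lemma canonical_adjudicator_computable:
  assumes "decidable_domain D"
  shows "computable_on (distinctions D) (canonical_adjudicator D)"
proof (rule computable_onI)
  \<comment> \<open>On the domain, failing to lie in the decided set means failing to be
    manifest.\<close>
  show "computable (\<lambda>p. of_bool (p \<notin> {p \<in> distinctions D. p \<in> manifest D}))"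
    using assms unfolding decidable_domain_def decidable_set_iff by (intro computable_intro)
qed (simp add: canonical_adjudicator_def)


section \<open>Correctness of the automata\<close>

lemma finite_tm_vars: "finite (tm_vars t)"
  by (induction t) auto

lemma finite_free_vars: "finite (free_vars \<phi>)"
  by (induction \<phi>) (auto simp: finite_tm_vars)

text \<open>The sum runs over any finite superset of the variables, so that both sides of an
  equation can be summed over the same set.\<close>

lemma tm_val_linear:
  assumes "finite V" "tm_vars t \<subseteq> V"
  shows "int (tm_val e t) = tm_const t + (\<Sum>x\<in>V. tm_coeff t x * int (e x))"
  using assms(2)
proof (induction t)
  case (TVar y)
  then have "(\<Sum>x\<in>V. of_bool (y = x) * int (e x)) = (\<Sum>x\<in>{y}. int (e x))"
    by (intro sum.mono_neutral_cong_right assms(1)) auto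
  then show ?case by simp
qed (auto simp: sum.distrib algebra_simps)

lemma sat_cong: "(\<And>x. x \<in> free_vars \<phi> \<Longrightarrow> e x = e' x) \<Longrightarrow> sat e \<phi> = sat e' \<phi>"
proof (induction \<phi> arbitrary: e e')
  case (Eq s t)
  have "tm_val e u = tm_val e' u" if "tm_vars u \<subseteq> tm_vars s \<union> tm_vars t" for u
    using Eq that by (induction u) auto
  then show ?case by simp
next
  case (Neg \<phi>)
  have "sat e \<phi> = sat e' \<phi>" by (rule Neg.IH) (use Neg.prems in simp)
  then show ?case by simp
next
  case (Conj \<phi> \<psi>)
  have "sat e \<phi> = sat e' \<phi>" "sat e \<psi> = sat e' \<psi>"
    by (rule Conj; use Conj.prems in simp)+
  then show ?case by simp
next
  case (Ex x \<phi>)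
  have "sat (e(x := n)) \<phi> = sat (e'(x := n)) \<phi>" for n
    by (rule Ex.IH) (use Ex.prems in auto)
  then show ?case by simp
qed

lemma word_val_Nil [simp]: "word_val [] x = 0"
  by (simp add: word_val_def)

lemma word_val_Cons [simp]: "word_val (a # u) x = of_bool (x \<in> a) + 2 * word_val u x"
proof -
  have "word_val (a # u) x = (\<Sum>i<Suc (length u). if x \<in> (a # u) ! i then 2 ^ i else 0)"
    by (simp add: word_val_def)
  also have "\<dots> = of_bool (x \<in> a) + (\<Sum>i<length u. if x \<in> u ! i then 2 ^ Suc i else 0)"
    by (subst sum.lessThan_Suc_shift) simp
  also have "(\<Sum>i<length u. if x \<in> u ! i then 2 ^ Suc i else 0) = 2 * word_val u x"
    by (auto simp: word_val_def sum_distrib_left intro!: sum.cong)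
  finally show ?thesis .
qed

lemma word_val_append: "word_val (u @ v) x = word_val u x + 2 ^ length u * word_val v x"
  by (induction u) (auto simp: algebra_simps)

definition dfa_reach :: "dfa \<Rightarrow> nat \<Rightarrow> nat set list \<Rightarrow> nat" where
  "dfa_reach A = foldl (dfa_next A)"

lemma dfa_reach_simps [simp]:
  "dfa_reach A q [] = q"
  "dfa_reach A q (a # u) = dfa_reach A (dfa_next A q a) u"
  "dfa_reach A q (u @ v) = dfa_reach A (dfa_reach A q u) v"
  by (simp_all add: dfa_reach_def)

lemma last_run_from: "last (run_from A q u) = dfa_reach A q u"
proof (induction u arbitrary: q)
  case (Cons a u)
  have "run_from A q' u \<noteq> []" for q' by (cases u) auto
  with Cons show ?case by simp
qed simp

lemma dfa_accepts_iff: "dfa_accepts A u \<longleftrightarrow> dfa_reach A (dfa_init A) u \<in> dfa_final A"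
  by (simp add: dfa_accepts_def dfa_run_def last_run_from)


subsection \<open>Equations\<close>

abbreviation diff_coeff :: "tm \<Rightarrow> tm \<Rightarrow> nat \<Rightarrow> int" where
  "diff_coeff s t x \<equiv> tm_coeff s x - tm_coeff t x"

definition eq_bound :: "tm \<Rightarrow> tm \<Rightarrow> int" where
  "eq_bound s t = \<bar>tm_const t - tm_const s\<bar> + (\<Sum>x\<in>tm_vars s \<union> tm_vars t. \<bar>diff_coeff s t x\<bar>)"

lemma eq_dfa_simps:
  "dfa_states (eq_dfa s t) = insert 0 ((\<lambda>r. Suc (int_encode r)) ` {- eq_bound s t .. eq_bound s t})"
  "dfa_init (eq_dfa s t) = Suc (int_encode (tm_const t - tm_const s))"
  "dfa_final (eq_dfa s t) = {Suc (int_encode 0)}"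
  "dfa_next (eq_dfa s t) 0 a = 0"
  "dfa_next (eq_dfa s t) (Suc k) a =
    (let r' = int_decode k - (\<Sum>x \<in> a \<inter> (tm_vars s \<union> tm_vars t). diff_coeff s t x)
     in if even r' then Suc (int_encode (r' div 2)) else 0)"
  by (simp_all add: eq_dfa_def eq_bound_def Let_def)

lemma finite_dfa_eq: "finite_dfa (tm_vars s \<union> tm_vars t) (eq_dfa s t)"
proof -
  let ?V = "tm_vars s \<union> tm_vars t" and ?B = "eq_bound s t"
  have "dfa_next (eq_dfa s t) q a \<in> dfa_states (eq_dfa s t)"
    if q: "q \<in> dfa_states (eq_dfa s t)" for q a
  proof (cases q)
    case (Suc k)
    then obtain r where r: "k = int_encode r" "\<bar>r\<bar> \<le> ?B"
      using q by (auto simp: eq_dfa_simps)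
    define d where "d = (\<Sum>x \<in> a \<inter> ?V. diff_coeff s t x)"
    have "\<bar>d\<bar> \<le> (\<Sum>x \<in> a \<inter> ?V. \<bar>diff_coeff s t x\<bar>)"
      unfolding d_def by (rule sum_abs)
    also have "\<dots> \<le> (\<Sum>x \<in> ?V. \<bar>diff_coeff s t x\<bar>)"
      by (rule sum_mono2) (auto simp: finite_tm_vars)
    also have "\<dots> \<le> ?B" by (simp add: eq_bound_def)
    finally have "\<bar>d\<bar> \<le> ?B" .
    \<comment> \<open>Both \<open>r\<close> and \<open>d\<close> have modulus at most
      \<open>?B\<close>, so half of their difference stays within the bound.\<close>
    then have "- ?B \<le> (r - d) div 2" "(r - d) div 2 \<le> ?B" if "even (r - d)"
      using r(2) that by (auto elim!: evenE)
    then show ?thesis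
      using Suc r(1) by (auto simp: eq_dfa_simps Let_def d_def[symmetric] simp del: even_diff)
  qed (simp add: eq_dfa_simps)
  moreover have "0 \<le> (\<Sum>x\<in>?V. \<bar>diff_coeff s t x\<bar>)" by (rule sum_nonneg) simp
  then have "- ?B \<le> 0" "0 \<le> ?B" "- ?B \<le> tm_const t - tm_const s" "tm_const t - tm_const s \<le> ?B"
    unfolding eq_bound_def by linarith+
  ultimately show ?thesis
    by (auto simp: finite_dfa_def finite_tm_vars eq_dfa_simps(1,2,3))
qed

lemma eq_dfa_reach_0: "dfa_reach (eq_dfa s t) 0 u = 0"
  by (induction u) (auto simp: eq_dfa_simps)

text \<open>Stated for every \<open>r\<close>, since the right-hand side is what changes along a
  word. The first letter holds the least significant digits: it contributes \<open>d\<close>, the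
  rest contributes \<open>2 * S\<close>, and \<open>d + 2 * S = r\<close> means that
  \<open>r - d\<close> is even with half \<open>S\<close>.\<close>

lemma eq_dfa_reach:
  "dfa_reach (eq_dfa s t) (Suc (int_encode r)) u \<in> dfa_final (eq_dfa s t) \<longleftrightarrow>
    (\<Sum>x\<in>tm_vars s \<union> tm_vars t. diff_coeff s t x * int (word_val u x)) = r"
proof (induction u arbitrary: r)
  case Nil
  then show ?case by (auto simp: eq_dfa_simps int_encode_eq)
next
  case (Cons a u)
  let ?V = "tm_vars s \<union> tm_vars t"
  define d where "d = (\<Sum>x \<in> a \<inter> ?V. diff_coeff s t x)"
  define S where "S = (\<Sum>x\<in>?V. diff_coeff s t x * int (word_val u x))"
  have "(\<Sum>x\<in>?V. diff_coeff s t x * of_bool (x \<in> a)) = d"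
    unfolding d_def by (rule sum.mono_neutral_cong_right) (auto simp: finite_tm_vars)
  then have "(\<Sum>x\<in>?V. diff_coeff s t x * int (word_val (a # u) x)) = d + 2 * S"
    by (simp add: S_def distrib_left sum.distrib sum_distrib_left mult.left_commute)
  moreover have "dfa_reach (eq_dfa s t) (Suc (int_encode r)) (a # u) \<in> dfa_final (eq_dfa s t) \<longleftrightarrow>
      even (r - d) \<and> S = (r - d) div 2"
    using Cons[of "(r - d) div 2"]
    by (simp add: eq_dfa_simps(4,5) Let_def d_def[symmetric] S_def[symmetric] eq_dfa_reach_0 del: even_diff)
      (simp add: eq_dfa_simps)
  moreover have "even (r - d) \<and> S = (r - d) div 2 \<longleftrightarrow> d + 2 * S = r" by presburger
  ultimately show ?case by (simp only:)
qed

lemma eq_dfa_accepts: "dfa_accepts (eq_dfa s t) u \<longleftrightarrow> sat (word_val u) (Eq s t)"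
proof -
  let ?V = "tm_vars s \<union> tm_vars t" and ?e = "word_val u"
  have V: "finite ?V" by (simp add: finite_tm_vars)
  have "sat ?e (Eq s t) \<longleftrightarrow> int (tm_val ?e s) = int (tm_val ?e t)" by simp
  also have "\<dots> \<longleftrightarrow> tm_const s + (\<Sum>x\<in>?V. tm_coeff s x * int (?e x)) =
      tm_const t + (\<Sum>x\<in>?V. tm_coeff t x * int (?e x))"
    by (simp only: tm_val_linear[OF V, of s] tm_val_linear[OF V, of t] Un_upper1 Un_upper2)
  also have "\<dots> \<longleftrightarrow> dfa_accepts (eq_dfa s t) u"
    unfolding dfa_accepts_iff eq_dfa_simps(2) eq_dfa_reach
    by (auto simp: left_diff_distrib sum_subtractf)
  finally show ?thesis by simp
qed


subsection \<open>Closure properties\<close>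

text \<open>Inside a conjunction or below a quantifier the automaton of a subformula meets letters
  over more variables than its own. It ignores the extra ones, so its set of states is closed under
  all letters.\<close>

lemma fm_dfa_next_Int: "dfa_next (fm_dfa \<phi>) q a = dfa_next (fm_dfa \<phi>) q (a \<inter> free_vars \<phi>)"
proof (induction \<phi> arbitrary: q a)
  case (Eq s t)
  show ?case
    by (cases q) (simp_all add: eq_dfa_simps Int_assoc)
next
  case (Conj \<phi> \<psi>)
  have "dfa_next (fm_dfa \<phi>) q (a \<inter> (free_vars \<phi> \<union> free_vars \<psi>)) = dfa_next (fm_dfa \<phi>) q a"
    "dfa_next (fm_dfa \<psi>) q (a \<inter> (free_vars \<phi> \<union> free_vars \<psi>)) = dfa_next (fm_dfa \<psi>) q a" for q
    by (subst (1 2) Conj; simp add: Int_assoc Int_absorb1)+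
  then show ?case by (simp add: conj_dfa_def)
next
  case (Ex x \<phi>)
  have "dfa_next (fm_dfa \<phi>) q (a \<inter> (free_vars \<phi> - {x}) - {x}) = dfa_next (fm_dfa \<phi>) q (a - {x})"
    "dfa_next (fm_dfa \<phi>) q (insert x (a \<inter> (free_vars \<phi> - {x}))) = dfa_next (fm_dfa \<phi>) q (insert x a)" for q
    by (subst (1 2) Ex; rule arg_cong[where f = "dfa_next _ _"]; auto)+
  then show ?case by (simp add: ex_dfa_def)
qed (simp add: neg_dfa_def)

lemma fm_dfa_next_in_states:
  assumes "finite_dfa (free_vars \<phi>) (fm_dfa \<phi>)" "q \<in> dfa_states (fm_dfa \<phi>)"
  shows "dfa_next (fm_dfa \<phi>) q a \<in> dfa_states (fm_dfa \<phi>)"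
  using assms by (subst fm_dfa_next_Int) (auto simp: finite_dfa_def)

lemma finite_dfa_fm: "finite_dfa (free_vars \<phi>) (fm_dfa \<phi>)"
proof (induction \<phi>)
  case (Conj \<phi> \<psi>)
  then show ?case
    using fm_dfa_next_in_states[OF Conj.IH(1)] fm_dfa_next_in_states[OF Conj.IH(2)]
    by (auto simp: finite_dfa_def conj_dfa_def finite_free_vars)
next
  case (Ex x \<phi>)
  then have "finite (dfa_states (fm_dfa \<phi>))" by (simp add: finite_dfa_def)
  \<comment> \<open>\<open>set_decode\<close> inverts \<open>set_encode\<close> on finite sets
    only.\<close>
  then have "set_decode (set_encode S) = S" if "S \<subseteq> dfa_states (fm_dfa \<phi>)" for S
    using that by (simp add: finite_subset)
  then show ?case
    using Ex fm_dfa_next_in_states[OF Ex.IH]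
    by (auto simp: finite_dfa_def ex_dfa_def finite_free_vars
        simp del: set_encode_insert intro!: imageI)
qed (use finite_dfa_eq in \<open>auto simp: finite_dfa_def neg_dfa_def\<close>)

lemma fm_dfa_reach_in_states:
  "q \<in> dfa_states (fm_dfa \<phi>) \<Longrightarrow> dfa_reach (fm_dfa \<phi>) q u \<in> dfa_states (fm_dfa \<phi>)"
  by (induction u arbitrary: q) (auto simp: fm_dfa_next_in_states finite_dfa_fm)

lemma fm_dfa_init_in_states: "dfa_init (fm_dfa \<phi>) \<in> dfa_states (fm_dfa \<phi>)"
  using finite_dfa_fm by (auto simp: finite_dfa_def)

lemma conj_dfa_reach:
  "dfa_reach (conj_dfa A B) (prod_encode (p, q)) u = prod_encode (dfa_reach A p u, dfa_reach B q u)"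
  by (induction u arbitrary: p q) (auto simp: conj_dfa_def)

text \<open>Words that differ at most in the track of \<open>x\<close>: the possible guesses of the
  digits of the projected variable.\<close>

definition agree_off :: "nat \<Rightarrow> nat set list \<Rightarrow> nat set list \<Rightarrow> bool" where
  "agree_off x = list_all2 (\<lambda>a b. a - {x} = b - {x})"

lemma agree_off_Cons:
  "agree_off x (a # u) v \<longleftrightarrow> (\<exists>b v'. v = b # v' \<and> b \<in> {a - {x}, insert x a} \<and> agree_off x u v')"
  unfolding agree_off_def list_all2_Cons1 by auto

text \<open>The subset automaton collects the states that \<open>A\<close> reaches under some guess
  of the track of \<open>x\<close>. The start set is arbitrary, because it changes in the
  induction.\<close>

lemma ex_dfa_reach:
  assumes "finite S"
  shows "dfa_reach (ex_dfa x A) (set_encode S) u =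
    set_encode {dfa_reach A q v | q v. q \<in> S \<and> agree_off x u v}"
  using assms
proof (induction u arbitrary: S)
  case Nil
  then show ?case by (simp add: agree_off_def)
next
  case (Cons a u)
  define S' where "S' = (\<Union>q \<in> S. {dfa_next A q (a - {x}), dfa_next A q (insert x a)})"
  have "finite S'" using Cons.prems by (simp add: S'_def)
  moreover have "dfa_reach (ex_dfa x A) (set_encode S) (a # u) = dfa_reach (ex_dfa x A) (set_encode S') u"
    using Cons.prems by (simp add: ex_dfa_def S'_def)
  moreover have "{dfa_reach A q v | q v. q \<in> S' \<and> agree_off x u v} =
      {dfa_reach A q v | q v. q \<in> S \<and> agree_off x (a # u) v}"
    unfolding agree_off_Cons S'_def by auto (metis dfa_reach_simps(2))+
  ultimately show ?case using Cons.IH by simp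
qed

lemma word_val_agree_off:
  "agree_off x u v \<Longrightarrow> y \<noteq> x \<Longrightarrow> word_val v y = word_val u y"
  unfolding agree_off_def
proof (induction rule: list_all2_induct)
  case (Cons a u b v)
  then have "y \<in> a \<longleftrightarrow> y \<in> b" by blast
  with Cons show ?case by simp
qed simp

lemma word_val_only: "u \<in> lists {{}, {x}} \<Longrightarrow> y \<noteq> x \<Longrightarrow> word_val u y = 0"
  by (induction u) auto

text \<open>\<open>v\<close> places the low digits of \<open>n\<close> over the given word, and
  \<open>w\<close> supplies those for which the word is too short. Removing the first letter goes
  with halving \<open>n\<close>.\<close>

lemma ex_word_with_value:
  "\<exists>v w. agree_off x u v \<and> w \<in> lists {{}, {x}} \<and> word_val (v @ w) x = n"
proof (induction u arbitrary: n)
  case Nil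
  have "\<exists>w \<in> lists {{}, {x}}. word_val w x = n" for n
  proof (induction n rule: less_induct)
    case (less n)
    show ?case
    proof (cases "n = 0")
      case False
      then obtain w where "w \<in> lists {{}, {x}}" "word_val w x = n div 2"
        using less[of "n div 2"] by auto
      then show ?thesis
        by (intro bexI[of _ "(if odd n then {x} else {}) # w"]) auto
    qed (auto intro!: bexI[of _ "[]"])
  qed
  then obtain w where "w \<in> lists {{}, {x}}" "word_val w x = n" by blast
  then show ?case by (auto simp: agree_off_def)
next
  case (Cons a u)
  obtain v w where vw: "agree_off x u v" "w \<in> lists {{}, {x}}" "word_val (v @ w) x = n div 2"
    using Cons by blast
  define b where "b = (if odd n then insert x a else a - {x})"
  have "x \<in> b \<longleftrightarrow> odd n" by (simp add: b_def)
  with vw(3) have "word_val ((b # v) @ w) x = n" by simp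
  moreover have "agree_off x (a # u) (b # v)"
    using vw(1) unfolding agree_off_Cons by (simp add: b_def)
  ultimately show ?case using vw(2) by blast
qed

lemma fm_dfa_accepts: "dfa_accepts (fm_dfa \<phi>) u \<longleftrightarrow> sat (word_val u) \<phi>"
proof (induction \<phi> arbitrary: u)
  case (Eq s t)
  show ?case using eq_dfa_accepts by simp
next
  case (Neg \<phi>)
  have "dfa_reach (neg_dfa A) q u = dfa_reach A q u" for A q
    by (simp add: dfa_reach_def neg_dfa_def)
  \<comment> \<open>Complementation is relative to \<open>dfa_states\<close>, so the reached state
    has to lie in that set.\<close>
  then show ?case
    using Neg[of u] fm_dfa_reach_in_states[OF fm_dfa_init_in_states]
    by (simp add: dfa_accepts_iff neg_dfa_def)
next
  case (Conj \<phi> \<psi>)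
  then show ?case
    by (auto simp: dfa_accepts_iff conj_dfa_reach conj_dfa_def[of "fm_dfa _"] conj_dfa_reach[unfolded conj_dfa_def])
next
  case (Ex x \<phi>)
  let ?A = "fm_dfa \<phi>"
  define R where "R = {dfa_reach ?A (dfa_init ?A) v | v. agree_off x u v}"
  have R: "R \<subseteq> dfa_states ?A"
    using fm_dfa_reach_in_states[OF fm_dfa_init_in_states] by (auto simp: R_def)
  have fin: "finite (dfa_states ?A)" using finite_dfa_fm by (auto simp: finite_dfa_def)
  have "dfa_reach (ex_dfa x ?A) (dfa_init (ex_dfa x ?A)) u = set_encode R"
    using ex_dfa_reach[of "{dfa_init ?A}" x ?A u] by (simp add: R_def ex_dfa_def)
  then have "dfa_accepts (fm_dfa (Ex x \<phi>)) u \<longleftrightarrow>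
      set_encode R \<in> set_encode ` {S. S \<subseteq> dfa_states ?A \<and>
        (\<exists>q \<in> S. \<exists>w \<in> lists {{}, {x}}. last (run_from ?A q w) \<in> dfa_final ?A)}"
    by (simp add: dfa_accepts_iff) (simp add: ex_dfa_def)
  \<comment> \<open>Distinct finite sets have distinct codes, so the membership concerns
    \<open>R\<close> itself.\<close>
  also have "\<dots> \<longleftrightarrow> (\<exists>q \<in> R. \<exists>w \<in> lists {{}, {x}}. dfa_reach ?A q w \<in> dfa_final ?A)"
    using R fin finite_subset[OF _ fin] by (auto simp: last_run_from set_encode_eq)
  also have "\<dots> \<longleftrightarrow> (\<exists>v w. agree_off x u v \<and> w \<in> lists {{}, {x}} \<and> dfa_accepts ?A (v @ w))"
    by (auto simp: R_def dfa_accepts_iff)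
  also have "\<dots> \<longleftrightarrow> (\<exists>v w. agree_off x u v \<and> w \<in> lists {{}, {x}} \<and> sat (word_val (v @ w)) \<phi>)"
    by (simp add: Ex.IH)
  \<comment> \<open>Neither the changed track nor the appended letters affect another variable, and
    by \<open>ex_word_with_value\<close> every \<open>n\<close> occurs as the value of
    \<open>x\<close>.\<close>
  also have "\<dots> \<longleftrightarrow> (\<exists>n. sat ((word_val u)(x := n)) \<phi>)"
  proof -
    have "word_val (v @ w) = (word_val u)(x := word_val (v @ w) x)"
      if "agree_off x u v" "w \<in> lists {{}, {x}}" for v w
      using word_val_agree_off[OF that(1)] word_val_only[OF that(2)]
      by (auto simp: word_val_append)
    then show ?thesis using ex_word_with_value[of x u] by metis
  qed
  finally show ?case by simp
qed


section \<open>Codes of terms and formulas\<close>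

text \<open>Recursion on codes can descend safely under a nonzero tag only:
  \<open>prod_encode (0, 0)\<close> is its own second component. The constructors with tag 0 are
  \<open>Zero\<close>, \<open>Eq\<close> and \<open>Void\<close>, under which the functions on
  terms, formulas and expressions make no recursive call.\<close>

lemma components_less:
  assumes "pfst x \<noteq> 0"
  shows "psnd x < x" "pfst (psnd x) < x" "psnd (psnd x) < x"
proof -
  show "psnd x < x" using add_le_prod_encode[of "pfst x" "psnd x"] assms by simp
  then show "pfst (psnd x) < x" "psnd (psnd x) < x"
    using pfst_le[of "psnd x"] psnd_le[of "psnd x"] by auto
qed

lemma code_components_less:
  assumes "0 < k"
  shows "a < prod_encode (k, a)" "a < prod_encode (k, prod_encode (a, b))"
    "b < prod_encode (k, prod_encode (a, b))"
  using assms components_less[of "prod_encode (k, a)"]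
    components_less[of "prod_encode (k, prod_encode (a, b))"] by auto

lemma prod_encode_mono: "a \<le> a' \<Longrightarrow> b \<le> b' \<Longrightarrow> prod_encode (a, b) \<le> prod_encode (a', b')"
  by (simp add: prod_encode_def add_mono triangle_mono)

lemma tm_code_eq_iff [simp]: "tm_code s = tm_code t \<longleftrightarrow> s = t"
proof
  show "tm_code s = tm_code t \<Longrightarrow> s = t"
    by (induction s arbitrary: t) (case_tac t; auto)+
qed simp

lemma fm_code_eq_iff [simp]: "fm_code \<phi> = fm_code \<psi> \<longleftrightarrow> \<phi> = \<psi>"
proof
  show "fm_code \<phi> = fm_code \<psi> \<Longrightarrow> \<phi> = \<psi>"
    by (induction \<phi> arbitrary: \<psi>) (case_tac \<psi>; auto)+
qed simp

lemma ex_tm_iff: "(\<exists>t. P t) \<longleftrightarrow> P Zero \<or> P One \<or> (\<exists>x. P (TVar x)) \<or> (\<exists>s t. P (Add s t))"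
  by (metis tm.exhaust)

lemma ex_fm_iff:
  "(\<exists>\<phi>. P \<phi>) \<longleftrightarrow> (\<exists>s t. P (Eq s t)) \<or> (\<exists>\<phi>. P (Neg \<phi>)) \<or> (\<exists>\<phi> \<psi>. P (Conj \<phi> \<psi>)) \<or> (\<exists>x \<phi>. P (Ex x \<phi>))"
  by (metis fm.exhaust)

text \<open>By cases on the constructor: only under tag 3 is the question asked again, and of
  smaller numbers. This is the recursion equation of the test.\<close>

lemma is_tm_code_iff:
  "(\<exists>t. x = tm_code t) \<longleftrightarrow> psnd x = 0 \<and> (pfst x = 0 \<or> pfst x = 1) \<or> pfst x = 2 \<or>
    pfst x = 3 \<and> (\<exists>t. pfst (psnd x) = tm_code t) \<and> (\<exists>t. psnd (psnd x) = tm_code t)"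
  by (simp add: ex_tm_iff[of "\<lambda>t. x = tm_code t"] prod_encode_eq_iff del: One_nat_def) blast

lemma is_fm_code_iff:
  "(\<exists>\<phi>. x = fm_code \<phi>) \<longleftrightarrow>
    pfst x = 0 \<and> (\<exists>t. pfst (psnd x) = tm_code t) \<and> (\<exists>t. psnd (psnd x) = tm_code t) \<or>
    pfst x = 1 \<and> (\<exists>\<phi>. psnd x = fm_code \<phi>) \<or>
    pfst x = 2 \<and> (\<exists>\<phi>. pfst (psnd x) = fm_code \<phi>) \<and> (\<exists>\<phi>. psnd (psnd x) = fm_code \<phi>) \<or>
    pfst x = 3 \<and> (\<exists>\<phi>. psnd (psnd x) = fm_code \<phi>)"
  by (simp add: ex_fm_iff[of "\<lambda>\<phi>. x = fm_code \<phi>"] prod_encode_eq_iff del: One_nat_def)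

lemma computable_is_tm_code [computable_intro]:
  assumes "computable f"
  shows "decidable_pred (\<lambda>x. \<exists>t. f x = tm_code t)"
proof (rule computable_courseI[where f = "\<lambda>_ x. of_bool (\<exists>t. x = tm_code t)" and p = "\<lambda>_. 0"
      and G = "\<lambda>_ x h. of_bool (psnd x = 0 \<and> (pfst x = 0 \<or> pfst x = 1) \<or> pfst x = 2 \<or>
        pfst x = 3 \<and> lookup x h (pfst (psnd x)) = 1 \<and> lookup x h (psnd (psnd x)) = 1)"])
  let ?is = "\<lambda>x. of_bool (\<exists>t. x = tm_code t) :: nat"
  show "?is x = of_bool (psnd x = 0 \<and> (pfst x = 0 \<or> pfst x = 1) \<or> pfst x = 2 \<or>
      pfst x = 3 \<and> lookup x (table ?is x) (pfst (psnd x)) = 1 \<and>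
        lookup x (table ?is x) (psnd (psnd x)) = 1)" for x
    by (subst is_tm_code_iff) (simp add: lookup_table components_less cong: conj_cong)
qed (intro computable_intro assms)+

lemma computable_is_fm_code [computable_intro]:
  assumes "computable f"
  shows "decidable_pred (\<lambda>x. \<exists>\<phi>. f x = fm_code \<phi>)"
proof (rule computable_courseI[where f = "\<lambda>_ x. of_bool (\<exists>\<phi>. x = fm_code \<phi>)" and p = "\<lambda>_. 0"
      and G = "\<lambda>_ x h. of_bool (
        pfst x = 0 \<and> (\<exists>t. pfst (psnd x) = tm_code t) \<and> (\<exists>t. psnd (psnd x) = tm_code t) \<or>
        pfst x = 1 \<and> lookup x h (psnd x) = 1 \<or>
        pfst x = 2 \<and> lookup x h (pfst (psnd x)) = 1 \<and> lookup x h (psnd (psnd x)) = 1 \<or>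
        pfst x = 3 \<and> lookup x h (psnd (psnd x)) = 1)"])
  let ?is = "\<lambda>x. of_bool (\<exists>\<phi>. x = fm_code \<phi>) :: nat"
  show "?is x = of_bool (
      pfst x = 0 \<and> (\<exists>t. pfst (psnd x) = tm_code t) \<and> (\<exists>t. psnd (psnd x) = tm_code t) \<or>
      pfst x = 1 \<and> lookup x (table ?is x) (psnd x) = 1 \<or>
      pfst x = 2 \<and> lookup x (table ?is x) (pfst (psnd x)) = 1 \<and>
        lookup x (table ?is x) (psnd (psnd x)) = 1 \<or>
      pfst x = 3 \<and> lookup x (table ?is x) (psnd (psnd x)) = 1)" for x
    by (subst is_fm_code_iff) (simp add: lookup_table components_less cong: conj_cong)
qed (intro computable_intro assms)+

section \<open>Occurrence of variables and recognition of sentences on codes\<close>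

definition occurs_tm :: "nat \<Rightarrow> nat \<Rightarrow> nat" where
  "occurs_tm = course (\<lambda>y x h.
     if pfst x = 2 then of_bool (psnd x = y)
     else if pfst x = 3 then of_bool (lookup x h (pfst (psnd x)) = 1 \<or> lookup x h (psnd (psnd x)) = 1)
     else 0)"

lemma occurs_tm_code: "occurs_tm y (tm_code t) = of_bool (y \<in> tm_vars t)"
  by (induction t)
    (auto simp: occurs_tm_def course_def[of _ _ "prod_encode _"] lookup_course_table code_components_less)

lemma computable_occurs_tm [computable_intro]:
  "computable f \<Longrightarrow> computable g \<Longrightarrow> computable (\<lambda>x. occurs_tm (f x) (g x))"
  unfolding occurs_tm_def by (rule computable_course) (intro computable_intro)

definition occurs_fm :: "nat \<Rightarrow> nat \<Rightarrow> nat" where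
  "occurs_fm = course (\<lambda>y x h.
     if pfst x = 0 then of_bool (occurs_tm y (pfst (psnd x)) = 1 \<or> occurs_tm y (psnd (psnd x)) = 1)
     else if pfst x = 1 then lookup x h (psnd x)
     else if pfst x = 2 then of_bool (lookup x h (pfst (psnd x)) = 1 \<or> lookup x h (psnd (psnd x)) = 1)
     else of_bool (pfst (psnd x) \<noteq> y \<and> lookup x h (psnd (psnd x)) = 1))"

lemma occurs_fm_code: "occurs_fm y (fm_code \<phi>) = of_bool (y \<in> free_vars \<phi>)"
  by (induction \<phi>)
    (auto simp: occurs_fm_def course_def[of _ _ "prod_encode _"] lookup_course_table
      code_components_less occurs_tm_code)

lemma computable_occurs_fm [computable_intro]:
  "computable f \<Longrightarrow> computable g \<Longrightarrow> computable (\<lambda>x. occurs_fm (f x) (g x))"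
  unfolding occurs_fm_def by (rule computable_course) (intro computable_intro)

lemma le_prod_encode_snd_fst: "a \<le> prod_encode (k, prod_encode (a, b))"
  and le_prod_encode_snd_snd: "b \<le> prod_encode (k, prod_encode (a, b))"
  using le_prod_encode_2[of "prod_encode (a, b)" k] le_prod_encode_1[of a b] le_prod_encode_2[of b a]
  by linarith+

lemma tm_vars_le_code: "x \<in> tm_vars t \<Longrightarrow> x \<le> tm_code t"
  by (induction t)
    (auto intro: le_prod_encode_2 order_trans[OF _ le_prod_encode_snd_fst]
      order_trans[OF _ le_prod_encode_snd_snd])

lemma free_vars_le_code: "x \<in> free_vars \<phi> \<Longrightarrow> x \<le> fm_code \<phi>"
  by (induction \<phi>)
    (auto dest!: tm_vars_le_code intro: order_trans[OF _ le_prod_encode_2] 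
      order_trans[OF _ le_prod_encode_snd_fst] order_trans[OF _ le_prod_encode_snd_snd])

text \<open>Free variables are at most the code of the formula, so their absence is a bounded
  condition.\<close>

definition sentence_code :: "nat \<Rightarrow> bool" where
  "sentence_code p \<longleftrightarrow> (\<exists>\<phi>. p = fm_code \<phi>) \<and> (\<forall>y<Suc p. occurs_fm y p \<noteq> 1)"

lemma sentence_code_iff: "sentence_code p \<longleftrightarrow> (\<exists>\<phi>. sentence \<phi> \<and> p = fm_code \<phi>)"
  unfolding sentence_code_def sentence_def
  using free_vars_le_code by (fastforce simp: occurs_fm_code less_Suc_eq_le simp del: One_nat_def)

lemma computable_sentence_code [computable_intro]:
  assumes "computable f"
  shows "decidable_pred (\<lambda>x. sentence_code (f x))"
  unfolding sentence_code_def by (intro computable_intro assms computable_comp[of f])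


section \<open>Computing the automata\<close>

text \<open>Recursive functions know natural numbers only, so integers appear as differences; this
  is the code of the integer \<open>m - n\<close>.\<close>

definition encode_diff :: "nat \<Rightarrow> nat \<Rightarrow> nat" where
  "encode_diff m n = (if n \<le> m then 2 * (m - n) else 2 * (n - m) - 1)"

lemma encode_diff_eq: "encode_diff m n = int_encode (int m - int n)"
  by (auto simp: encode_diff_def int_encode_def sum_encode_def nat_diff_distrib)

lemma computable_encode_diff [computable_intro]:
  "computable f \<Longrightarrow> computable g \<Longrightarrow> computable (\<lambda>x. encode_diff (f x) (g x))"
  unfolding encode_diff_def by (intro computable_intro)

text \<open>
  The parameter is a pair of a code of a set of variables, which are given the value 1 (all others
  have the value 0), and of the value given to \<open>One\<close>.
\<close>

definition tm_eval :: "nat \<Rightarrow> nat \<Rightarrow> nat" where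
  "tm_eval = course (\<lambda>p x h.
     if pfst x = 0 then 0
     else if pfst x = 1 then psnd p
     else if pfst x = 2 then of_bool (psnd x \<in> set_decode (pfst p))
     else lookup x h (pfst (psnd x)) + lookup x h (psnd (psnd x)))"

text \<open>Two instances matter: the empty set of variables with \<open>c = 1\<close> gives the
  constant of a term, and \<open>c = 0\<close> gives the sum of its coefficients over a
  letter.\<close>

lemma tm_eval_code:
  assumes "finite V" "tm_vars t \<subseteq> V"
  shows "int (tm_eval (prod_encode (a, c)) (tm_code t)) =
    int c * tm_const t + (\<Sum>x\<in>set_decode a \<inter> V. tm_coeff t x)"
  using assms(2)
proof (induction t)
  case (TVar y)
  have "(\<Sum>x\<in>set_decode a \<inter> V. of_bool (y = x)) = (\<Sum>x\<in>set_decode a \<inter> {y}. 1 :: int)"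
    using TVar by (intro sum.mono_neutral_cong_right) auto
  also have "\<dots> = of_bool (y \<in> set_decode a)" by simp
  finally show ?case
    by (simp add: tm_eval_def course_def[of _ _ "prod_encode _"])
qed (simp_all add: tm_eval_def course_def[of _ _ "prod_encode _"] lookup_course_table
    code_components_less sum.distrib algebra_simps)

lemma computable_tm_eval [computable_intro]:
  "computable f \<Longrightarrow> computable g \<Longrightarrow> computable (\<lambda>x. tm_eval (f x) (g x))"
  unfolding tm_eval_def by (rule computable_course) (intro computable_intro)

definition init_code :: "nat \<Rightarrow> nat" where
  "init_code = course (\<lambda>_ x h.
     if pfst x = 0 then Suc (encode_diff (tm_eval (prod_encode (0, 1)) (psnd (psnd x)))
       (tm_eval (prod_encode (0, 1)) (pfst (psnd x))))
     else if pfst x = 1 then lookup x h (psnd x)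
     else if pfst x = 2 then prod_encode (lookup x h (pfst (psnd x)), lookup x h (psnd (psnd x)))
     else 2 ^ lookup x h (psnd (psnd x))) 0"

lemma init_code_eq: "init_code (fm_code \<phi>) = dfa_init (fm_dfa \<phi>)"
proof (induction \<phi>)
  case (Eq s t)
  have "int (tm_eval (prod_encode (0, 1)) (tm_code u)) = tm_const u" for u
    using tm_eval_code[of "tm_vars u" u 0 1] by (simp add: finite_tm_vars)
  then show ?case
    by (simp add: init_code_def course_def eq_dfa_simps encode_diff_eq del: One_nat_def)
qed (simp_all add: init_code_def course_def[of _ _ "prod_encode _"] lookup_course_table
    code_components_less neg_dfa_def conj_dfa_def ex_dfa_def)

lemma computable_init_code [computable_intro]:
  "computable f \<Longrightarrow> computable (\<lambda>x. init_code (f x))"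
  unfolding init_code_def by (rule computable_course) (intro computable_intro; assumption?)+

text \<open>For an equation the right-hand sides have modulus at most the code \<open>x\<close>,
  \<open>int_encode\<close> at most doubles the modulus, and the state adds one. For
  \<open>Ex\<close>, a set of numbers up to \<open>b\<close> has a code below
  \<open>2 ^ Suc b\<close>.\<close>

definition state_bound :: "nat \<Rightarrow> nat" where
  "state_bound = course (\<lambda>_ x h.
     if pfst x = 0 then Suc (2 * x)
     else if pfst x = 1 then lookup x h (psnd x)
     else if pfst x = 2 then prod_encode (lookup x h (pfst (psnd x)), lookup x h (psnd (psnd x)))
     else 2 ^ Suc (lookup x h (psnd (psnd x)))) 0"

lemma computable_state_bound [computable_intro]:
  "computable f \<Longrightarrow> computable (\<lambda>x. state_bound (f x))"
  unfolding state_bound_def by (rule computable_course) (intro computable_intro; assumption?)+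

lemma state_bound_code:
  "state_bound (fm_code (Eq s t)) = Suc (2 * fm_code (Eq s t))"
  "state_bound (fm_code (Neg \<phi>)) = state_bound (fm_code \<phi>)"
  "state_bound (fm_code (Conj \<phi> \<psi>)) = prod_encode (state_bound (fm_code \<phi>), state_bound (fm_code \<psi>))"
  "state_bound (fm_code (Ex x \<phi>)) = 2 ^ Suc (state_bound (fm_code \<phi>))"
  by (simp_all add: state_bound_def course_def[of _ _ "prod_encode _"] lookup_course_table
      code_components_less)

lemma set_encode_less_power: "S \<subseteq> {..<n} \<Longrightarrow> set_encode S < 2 ^ n"
proof -
  assume "S \<subseteq> {..<n}"
  then have "set_encode S \<le> (\<Sum>i<n. 2 ^ i)"
    unfolding set_encode_def by (intro sum_mono2) auto
  also have "\<dots> < 2 ^ n" by (induction n) auto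
  finally show ?thesis .
qed

text \<open>The left-hand side counts the occurrences of \<open>One\<close> and of variables from
  \<open>V\<close>, each of which contributes at least 1 to the code.\<close>

lemma tm_size_le_code:
  assumes "finite V"
  shows "tm_const t + (\<Sum>x\<in>V. tm_coeff t x) \<le> int (tm_code t)"
proof (induction t)
  case One
  show ?case using add_le_prod_encode[of 1 0] by simp
next
  case (TVar x)
  have "(\<Sum>y\<in>V. of_bool (x = y)) \<le> (1 :: int)" unfolding of_bool_def using assms by simp
  moreover have "1 \<le> tm_code (TVar x)" using add_le_prod_encode[of 2 x] by simp
  ultimately show ?case by simp
next
  case (Add s t)
  have "tm_code s + tm_code t \<le> tm_code (Add s t)"
    using add_le_prod_encode[of "tm_code s" "tm_code t"]
      le_prod_encode_2[of "prod_encode (tm_code s, tm_code t)" 3] by simp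
  with Add show ?case by (simp add: sum.distrib)
qed simp

text \<open>Terms have no negative constants or coefficients, so the modulus of a difference is
  bounded by the sum of the two parts.\<close>

lemma eq_bound_le: "eq_bound s t \<le> int (tm_code s + tm_code t)"
proof -
  let ?V = "tm_vars s \<union> tm_vars t"
  have nonneg: "0 \<le> tm_const u" "0 \<le> tm_coeff u x" for u x
    by (induction u) auto
  have "eq_bound s t \<le> tm_const s + tm_const t + (\<Sum>x\<in>?V. tm_coeff s x + tm_coeff t x)"
    unfolding eq_bound_def
  proof (intro add_mono sum_mono)
    show "\<bar>tm_const t - tm_const s\<bar> \<le> tm_const s + tm_const t"
      using nonneg(1)[of s] nonneg(1)[of t] by linarith
    show "\<bar>diff_coeff s t x\<bar> \<le> tm_coeff s x + tm_coeff t x" for x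
      using nonneg(2)[of s x] nonneg(2)[of t x] by linarith
  qed
  then show ?thesis
    using tm_size_le_code[of ?V s] tm_size_le_code[of ?V t] by (simp add: sum.distrib finite_tm_vars)
qed

lemma int_encode_le: "int_encode r \<le> 2 * nat \<bar>r\<bar>"
  by (auto simp: int_encode_def sum_encode_def)

lemma states_le_bound: "q \<in> dfa_states (fm_dfa \<phi>) \<Longrightarrow> q \<le> state_bound (fm_code \<phi>)"
proof (induction \<phi> arbitrary: q)
  case (Eq s t)
  have "tm_code s + tm_code t \<le> fm_code (Eq s t)"
    using add_le_prod_encode[of "tm_code s" "tm_code t"]
      le_prod_encode_2[of "prod_encode (tm_code s, tm_code t)" 0] by simp
  then have "nat \<bar>r\<bar> \<le> fm_code (Eq s t)" if "\<bar>r\<bar> \<le> eq_bound s t" for r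
    using that eq_bound_le[of s t] by linarith
  then have "Suc (int_encode r) \<le> Suc (2 * fm_code (Eq s t))" if "\<bar>r\<bar> \<le> eq_bound s t" for r
    using int_encode_le[of r] that by (meson Suc_le_mono le_trans mult_le_mono2)
  with Eq show ?case unfolding state_bound_code by (auto simp: eq_dfa_simps)
next
  case (Ex x \<phi>)
  then obtain S where S: "q = set_encode S" "S \<subseteq> dfa_states (fm_dfa \<phi>)"
    by (auto simp: ex_dfa_def)
  then have "S \<subseteq> {..<Suc (state_bound (fm_code \<phi>))}"
    using Ex.IH by (auto simp: less_Suc_eq_le)
  then show ?case
    unfolding S(1) state_bound_code by (rule less_imp_le[OF set_encode_less_power])
qed (auto simp: state_bound_code neg_dfa_def conj_dfa_def intro: prod_encode_mono simp del: fm_code.simps)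

text \<open>The transition of \<open>eq_dfa\<close> without integers. If the state stands for the
  right-hand side \<open>r\<close> and the letter contributes \<open>d\<close>, then the integer
  \<open>m - n\<close> is \<open>r - d\<close>: \<open>m\<close> and \<open>n\<close> take up the
  positive and negative part of \<open>r\<close> together with the contribution of the letter
  through \<open>t\<close> and \<open>s\<close>. Halving and the doubling in
  \<open>int_encode\<close> cancel, which leaves \<open>m - n\<close> or
  \<open>n - m - 1\<close>.\<close>

definition eq_next :: "nat \<Rightarrow> nat \<Rightarrow> nat \<Rightarrow> nat \<Rightarrow> nat" where
  "eq_next s t q a =
    (if q = 0 then 0
     else let k = q - 1;
            m = (if even k then k div 2 else 0) + tm_eval (prod_encode (a, 0)) t;
            n = (if even k then 0 else Suc (k div 2)) + tm_eval (prod_encode (a, 0)) s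
          in if even (m + n) then Suc (if n \<le> m then m - n else n - m - 1) else 0)"

lemma int_decode_eq_diff:
  "int_decode k = int (if even k then k div 2 else 0) - int (if even k then 0 else Suc (k div 2))"
  by (simp add: int_decode_def sum_decode_def)

lemma int_encode_half:
  assumes "even (m + n)"
  shows "int_encode ((int m - int n) div 2) = (if n \<le> m then m - n else n - m - 1)"
proof -
  define r where "r = (int m - int n) div 2"
  have "even (int m - int n)" using assms by presburger
  then have "2 * r = int m - int n" unfolding r_def by (rule dvd_mult_div_cancel)
  then show ?thesis
    unfolding r_def[symmetric] by (auto simp: int_encode_def sum_encode_def)
qed

lemma eq_next_eq: "eq_next (tm_code s) (tm_code t) q a = dfa_next (eq_dfa s t) q (set_decode a)"
proof (cases q)
  case 0
  then show ?thesis by (simp add: eq_next_def eq_dfa_simps)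
next
  case (Suc k)
  let ?V = "tm_vars s \<union> tm_vars t"
  define m where "m = (if even k then k div 2 else 0) + tm_eval (prod_encode (a, 0)) (tm_code t)"
  define n where "n = (if even k then 0 else Suc (k div 2)) + tm_eval (prod_encode (a, 0)) (tm_code s)"
  have V: "finite ?V" by (simp add: finite_tm_vars)
  have "int (tm_eval (prod_encode (a, 0)) (tm_code s)) = (\<Sum>x\<in>set_decode a \<inter> ?V. tm_coeff s x)"
    "int (tm_eval (prod_encode (a, 0)) (tm_code t)) = (\<Sum>x\<in>set_decode a \<inter> ?V. tm_coeff t x)"
    by (simp_all add: tm_eval_code[OF V])
  then have r': "int_decode k - (\<Sum>x\<in>set_decode a \<inter> ?V. diff_coeff s t x) = int m - int n"
    unfolding m_def n_def int_decode_eq_diff[of k] by (simp add: sum_subtractf)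
  have "even (int m - int n) \<longleftrightarrow> even (m + n)" by presburger
  moreover have "eq_next (tm_code s) (tm_code t) q a =
      (if even (m + n) then Suc (if n \<le> m then m - n else n - m - 1) else 0)"
    unfolding eq_next_def m_def n_def Let_def Suc by simp
  ultimately show ?thesis
    unfolding Suc eq_dfa_simps(5) Let_def r' using int_encode_half[of m n] by simp
qed

lemma computable_eq_next [computable_intro]:
  assumes "computable s" "computable t" "computable q" "computable a"
  shows "computable (\<lambda>x. eq_next (s x) (t x) (q x) (a x))"
  unfolding eq_next_def Let_def by (intro computable_intro assms)

text \<open>
  The parameter is a pair of a bound on the states and of a bound on the variables. Transitions are
  tabulated for all states and all letters within these bounds, since the transition table of
  \<open>Ex x \<phi>\<close> needs those of \<open>\<phi>\<close> at many places.
\<close>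

definition table_size :: "nat \<Rightarrow> nat" where
  "table_size b = Suc (prod_encode (pfst b, 2 ^ Suc (psnd b)))"

text \<open>\<open>N\<close> stands for the transition functions of the subformulas: the recursion
  instantiates it by lookups in the tables below \<open>x\<close>, the correctness proof by
  \<open>next_code\<close> itself.\<close>

definition next_entry :: "nat \<Rightarrow> (nat \<Rightarrow> nat \<Rightarrow> nat \<Rightarrow> nat) \<Rightarrow> nat \<Rightarrow> nat \<Rightarrow> nat \<Rightarrow> nat" where
  "next_entry b N x q a =
    (let l = pfst (psnd x); r = psnd (psnd x)
     in if pfst x = 0 then eq_next l r q a
        else if pfst x = 1 then N (psnd x) q a
        else if pfst x = 2 then prod_encode (N l (pfst q) a, N r (psnd q) a)
        else set_encode {y. y < Suc (pfst b) \<and> (\<exists>p<Suc (pfst b). p \<in> set_decode q \<and>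
          (y = N r p (set_encode {i. i < Suc (psnd b) \<and> i \<in> set_decode a \<and> i \<noteq> l}) \<or>
           y = N r p (set_encode {i. i < Suc (psnd b) \<and> (i = l \<or> i \<in> set_decode a)})))})"

definition next_table :: "nat \<Rightarrow> nat \<Rightarrow> nat" where
  "next_table = course (\<lambda>b x h. table (\<lambda>i. next_entry b
     (\<lambda>y q a. lookup (table_size b) (lookup x h y) (prod_encode (q, a))) x (pfst i) (psnd i))
     (table_size b))"

definition next_code :: "nat \<Rightarrow> nat \<Rightarrow> nat \<Rightarrow> nat \<Rightarrow> nat" where
  "next_code b x q a = lookup (table_size b) (next_table b x) (prod_encode (q, a))"

lemma computable_next_table:
  assumes "computable b" "computable x"
  shows "computable (\<lambda>z. next_table (b z) (x z))"
  unfolding next_table_def table_size_def next_entry_def Let_def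
  by (rule computable_course) (intro computable_intro assms)+

lemma computable_next_code [computable_intro]:
  assumes "computable b" "computable x" "computable q" "computable a"
  shows "computable (\<lambda>z. next_code (b z) (x z) (q z) (a z))"
  unfolding next_code_def table_size_def by (intro computable_intro computable_next_table assms)

text \<open>The two bounds ensure that the entry lies inside the table, where the recursion equation
  holds.\<close>

lemma next_code_unfold:
  assumes "q \<le> pfst b" "a < 2 ^ Suc (psnd b)"
  shows "next_code b x q a = next_entry b (next_code b) x q a"
proof -
  \<comment> \<open>\<open>L\<close> is what the recursion sees in place of
    \<open>next_code\<close>; the two agree below \<open>x\<close>.\<close>
  define L where "L = (\<lambda>y q a. lookup (table_size b)
    (lookup x (course_table (\<lambda>b x h. table (\<lambda>i. next_entry b
       (\<lambda>y q a. lookup (table_size b) (lookup x h y) (prod_encode (q, a))) x (pfst i) (psnd i))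
       (table_size b)) b x) y) (prod_encode (q, a)))"
  have L: "L y = next_code b y" if "y < x" for y
    unfolding L_def next_code_def next_table_def using that by (simp add: lookup_course_table)
  have "prod_encode (q, a) < table_size b"
    unfolding table_size_def less_Suc_eq_le by (rule prod_encode_mono) (use assms in auto)
  then have "next_code b x q a = next_entry b L x q a"
    unfolding next_code_def next_table_def course_def L_def by (simp add: lookup_table)
  also have "\<dots> = next_entry b (next_code b) x q a"
    unfolding next_entry_def Let_def by (simp add: L components_less)
  finally show ?thesis .
qed

lemma mem_set_decode_less:
  assumes "i \<in> set_decode a" "a < 2 ^ n"
  shows "i < n"
proof (rule ccontr)
  assume "\<not> i < n"
  then have "(2 :: nat) ^ n \<le> 2 ^ i" by (intro power_increasing) auto
  then have "a div 2 ^ i = 0" using assms(2) by (intro div_less) (rule less_le_trans)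
  with assms(1) show False by (simp add: set_decode_def)
qed

lemma subformula_le:
  "fm_code \<phi> \<le> fm_code (Neg \<phi>)"
  "fm_code \<phi> \<le> fm_code (Conj \<phi> \<psi>)" "fm_code \<psi> \<le> fm_code (Conj \<phi> \<psi>)"
  "x \<le> fm_code (Ex x \<phi>)" "fm_code \<phi> \<le> fm_code (Ex x \<phi>)"
  by (simp_all add: le_prod_encode_2 le_prod_encode_snd_fst le_prod_encode_snd_snd)

lemma state_bound_subformula_le:
  "state_bound (fm_code \<phi>) \<le> state_bound (fm_code (Conj \<phi> \<psi>))"
  "state_bound (fm_code \<psi>) \<le> state_bound (fm_code (Conj \<phi> \<psi>))"
  "state_bound (fm_code \<phi>) \<le> state_bound (fm_code (Ex x \<phi>))"
  unfolding state_bound_code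
  by (rule le_prod_encode_1, rule le_prod_encode_2, rule less_imp_le[OF less_trans[OF lessI less_exp]])

text \<open>\<open>Q\<close> and \<open>N\<close> stay fixed while the induction descends, as the
  parameter of the recursion does; hence they are only required to be large enough.\<close>

lemma next_code_eq:
  assumes "fm_code \<phi> \<le> N" "state_bound (fm_code \<phi>) \<le> Q"
    and "q \<in> dfa_states (fm_dfa \<phi>)" "a < 2 ^ Suc N"
  shows "next_code (prod_encode (Q, N)) (fm_code \<phi>) q a = dfa_next (fm_dfa \<phi>) q (set_decode a)"
  using assms
proof (induction \<phi> arbitrary: q a)
  case (Eq s t)
  have "q \<le> Q" using states_le_bound Eq.prems le_trans by blast
  with Eq.prems show ?case
    by (simp add: next_code_unfold next_entry_def eq_next_eq del: power_Suc One_nat_def)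
next
  case (Neg \<phi>)
  have "q \<le> Q" using states_le_bound Neg.prems le_trans by blast
  moreover have "fm_code \<phi> \<le> N"
    using Neg.prems(1) subformula_le(1) le_trans by blast
  ultimately show ?case
    using Neg.IH[of q a] Neg.prems by (subst next_code_unfold)
      (simp_all add: next_entry_def state_bound_code[simplified] neg_dfa_def del: power_Suc)
next
  case (Conj \<phi> \<psi>)
  have q: "q \<le> Q" using states_le_bound Conj.prems le_trans by blast
  have N: "fm_code \<phi> \<le> N" "fm_code \<psi> \<le> N"
    using Conj.prems(1) subformula_le(2,3) le_trans by blast+
  have Q: "state_bound (fm_code \<phi>) \<le> Q" "state_bound (fm_code \<psi>) \<le> Q"
    using Conj.prems(2) state_bound_subformula_le(1,2) le_trans by blast+
  obtain q1 q2 where "q = prod_encode (q1, q2)" "q1 \<in> dfa_states (fm_dfa \<phi>)" "q2 \<in> dfa_states (fm_dfa \<psi>)"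
    using Conj.prems(3) by (auto simp: conj_dfa_def)
  then show ?case
    using Conj.IH q N Q Conj.prems(4)
    by (simp add: next_code_unfold next_entry_def conj_dfa_def del: power_Suc)
next
  case (Ex x \<phi>)
  let ?A = "fm_dfa \<phi>" and ?b = "prod_encode (Q, N)"
  have q: "q \<le> Q" using states_le_bound Ex.prems le_trans by blast
  have N: "x \<le> N" "fm_code \<phi> \<le> N"
    using Ex.prems(1) subformula_le(4,5) le_trans by blast+
  have Q: "state_bound (fm_code \<phi>) \<le> Q"
    using Ex.prems(2) state_bound_subformula_le(3) le_trans by blast
  obtain S where S: "q = set_encode S" "S \<subseteq> dfa_states ?A"
    using Ex.prems(3) by (auto simp: ex_dfa_def)
  have "finite (dfa_states ?A)" using finite_dfa_fm by (auto simp: finite_dfa_def)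
  then have dec_q: "set_decode q = S" using S by (simp add: finite_subset)
  have le_Q: "p \<le> Q" if "p \<in> dfa_states ?A" for p
    using states_le_bound[OF that] Q by simp
  have dec_a: "set_decode a \<subseteq> {..<Suc N}"
    using mem_set_decode_less Ex.prems(4) by blast
  have "{i. i < Suc N \<and> i \<in> set_decode a \<and> i \<noteq> x} = set_decode a - {x}"
    "{i. i < Suc N \<and> (i = x \<or> i \<in> set_decode a)} = insert x (set_decode a)"
    using dec_a N(1) by auto
  moreover have "next_code ?b (fm_code \<phi>) p (set_encode B) = dfa_next ?A p B"
    if "p \<in> S" "B \<subseteq> {..<Suc N}" for p B
    using Ex.IH[OF N(2) Q, of p "set_encode B"] set_encode_less_power[OF that(2)] S(2) that
    by (auto simp: finite_subset[OF that(2)])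
  moreover have "set_decode a - {x} \<subseteq> {..<Suc N}" "insert x (set_decode a) \<subseteq> {..<Suc N}"
    using dec_a N(1) by auto
  ultimately have "next_code ?b (fm_code (Ex x \<phi>)) q a =
      set_encode {y. y < Suc Q \<and> (\<exists>p<Suc Q. p \<in> S \<and>
        (y = dfa_next ?A p (set_decode a - {x}) \<or> y = dfa_next ?A p (insert x (set_decode a))))}"
    using q Ex.prems(4)
    by (simp add: next_code_unfold next_entry_def dec_q del: power_Suc cong: conj_cong)
  also have "{y. y < Suc Q \<and> (\<exists>p<Suc Q. p \<in> S \<and>
        (y = dfa_next ?A p (set_decode a - {x}) \<or> y = dfa_next ?A p (insert x (set_decode a))))} =
      (\<Union>p\<in>S. {dfa_next ?A p (set_decode a - {x}), dfa_next ?A p (insert x (set_decode a))})"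
    using S(2) le_Q fm_dfa_next_in_states[OF finite_dfa_fm] by (fastforce simp: less_Suc_eq_le)
  finally show ?case by (simp add: ex_dfa_def dec_q)
qed

section \<open>Final states on codes\<close>

text \<open>
  Some state reachable from \<open>q\<close> by the letters \<open>{}\<close> and \<open>{x}\<close> is final iff every set of states
  which contains \<open>q\<close> and is closed under these letters contains a final state.
\<close>

definition final_code :: "nat \<Rightarrow> nat \<Rightarrow> nat" where
  "final_code = course (\<lambda>b x h.
     if pfst x = 0 then 2
     else if pfst x = 1 then set_encode {q. q < Suc (pfst b) \<and> q \<notin> set_decode (lookup x h (psnd x))}
     else if pfst x = 2 then set_encode {q. q < Suc (pfst b) \<and>
       pfst q \<in> set_decode (lookup x h (pfst (psnd x))) \<and>
       psnd q \<in> set_decode (lookup x h (psnd (psnd x)))}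
     else set_encode {S. S < Suc (pfst b) \<and> (\<exists>q<Suc (pfst b). q \<in> set_decode S \<and>
       (\<forall>T<2 ^ Suc (pfst b). q \<in> set_decode T \<and>
         (\<forall>r<Suc (pfst b). r \<in> set_decode T \<longrightarrow>
           next_code b (psnd (psnd x)) r 0 \<in> set_decode T \<and>
           next_code b (psnd (psnd x)) r (2 ^ pfst (psnd x)) \<in> set_decode T) \<longrightarrow>
         (\<exists>r<Suc (pfst b). r \<in> set_decode T \<and> r \<in> set_decode (lookup x h (psnd (psnd x))))))})"

lemma computable_final_code [computable_intro]:
  assumes "computable b" "computable x"
  shows "computable (\<lambda>z. final_code (b z) (x z))"
  unfolding final_code_def by (rule computable_course) (intro computable_intro assms)+

text \<open>A closed set containing \<open>q\<close> contains all that \<open>q\<close> reaches;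
  conversely the set of all reachable states is closed and its code is one of the \<open>T\<close>.
  A bounded quantifier thus replaces the search over words. \<open>N0\<close>, \<open>N1\<close> and
  \<open>F\<close> stand for computed data that are known to be right on genuine states
  only.\<close>

lemma reachable_iff_closed_sets:
  assumes q: "q \<in> dfa_states (fm_dfa \<phi>)"
    and Q: "\<And>p. p \<in> dfa_states (fm_dfa \<phi>) \<Longrightarrow> p < Q"
    and N: "\<And>p. p \<in> dfa_states (fm_dfa \<phi>) \<Longrightarrow> N0 p = dfa_next (fm_dfa \<phi>) p {}"
      "\<And>p. p \<in> dfa_states (fm_dfa \<phi>) \<Longrightarrow> N1 p = dfa_next (fm_dfa \<phi>) p {x}"
    and F: "\<And>p. p \<in> dfa_states (fm_dfa \<phi>) \<Longrightarrow> p \<in> F \<longleftrightarrow> p \<in> dfa_final (fm_dfa \<phi>)"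
  shows "(\<exists>u \<in> lists {{}, {x}}. last (run_from (fm_dfa \<phi>) q u) \<in> dfa_final (fm_dfa \<phi>)) \<longleftrightarrow>
    (\<forall>T<2 ^ Q. q \<in> set_decode T \<and>
      (\<forall>r<Q. r \<in> set_decode T \<longrightarrow> N0 r \<in> set_decode T \<and> N1 r \<in> set_decode T) \<longrightarrow>
      (\<exists>r<Q. r \<in> set_decode T \<and> r \<in> F))" (is "_ \<longleftrightarrow> (\<forall>T<2 ^ Q. ?closed T \<longrightarrow> ?meets T)")
proof
  let ?A = "fm_dfa \<phi>"
  assume "\<exists>u \<in> lists {{}, {x}}. last (run_from ?A q u) \<in> dfa_final ?A"
  then obtain u where u: "u \<in> lists {{}, {x}}" "dfa_reach ?A q u \<in> dfa_final ?A"
    by (auto simp: last_run_from)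
  show "\<forall>T<2 ^ Q. ?closed T \<longrightarrow> ?meets T"
  proof (intro allI impI)
    fix T assume T: "?closed T"
    have "dfa_reach ?A p u \<in> set_decode T" if "p \<in> set_decode T" "p \<in> dfa_states ?A" for p
      using u(1) that
    proof (induction u arbitrary: p)
      case (Cons a u)
      then have p: "p \<in> set_decode T" "p \<in> dfa_states ?A" "a = {} \<or> a = {x}" by auto
      then have "N0 p \<in> set_decode T" "N1 p \<in> set_decode T" using T Q[OF p(2)] by blast+
      then have "dfa_next ?A p a \<in> set_decode T" using p N[OF p(2)] by auto
      with Cons show ?case by (auto simp: fm_dfa_next_in_states finite_dfa_fm)
    qed simp
    then have "dfa_reach ?A q u \<in> set_decode T" using T q by blast
    then show "?meets T"
      using fm_dfa_reach_in_states[OF q] Q F u(2) by blast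
  qed
next
  let ?A = "fm_dfa \<phi>"
  assume *: "\<forall>T<2 ^ Q. ?closed T \<longrightarrow> ?meets T"
  define R where "R = dfa_reach ?A q ` lists {{}, {x}}"
  have R: "R \<subseteq> dfa_states ?A" using fm_dfa_reach_in_states[OF q] by (auto simp: R_def)
  then have "R \<subseteq> {..<Q}" using Q by auto
  then have dec: "set_decode (set_encode R) = R" and less: "set_encode R < 2 ^ Q"
    by (auto simp: finite_subset set_encode_less_power)
  have "dfa_next ?A r a \<in> R" if "r \<in> R" "a \<in> {{}, {x}}" for r a
  proof -
    obtain u where "u \<in> lists {{}, {x}}" "r = dfa_reach ?A q u" using \<open>r \<in> R\<close> by (auto simp: R_def)
    then have "u @ [a] \<in> lists {{}, {x}}" "dfa_next ?A r a = dfa_reach ?A q (u @ [a])"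
      using that(2) by auto
    then show ?thesis unfolding R_def by blast
  qed
  then have "N0 r \<in> R" "N1 r \<in> R" if "r \<in> R" for r
    using that R N by auto
  moreover have "q \<in> R"
    unfolding R_def by (rule image_eqI[of _ _ "[]"]) auto
  ultimately have "?closed (set_encode R)" unfolding dec by blast
  then have "?meets (set_encode R)" using * less by blast
  then obtain r where "r \<in> R" "r \<in> F" using dec by auto
  then show "\<exists>u \<in> lists {{}, {x}}. last (run_from ?A q u) \<in> dfa_final ?A"
    using F R by (auto simp: R_def last_run_from)
qed

lemma final_code_eq:
  assumes "fm_code \<phi> \<le> N" "state_bound (fm_code \<phi>) \<le> Q" "q \<in> dfa_states (fm_dfa \<phi>)"
  shows "q \<in> set_decode (final_code (prod_encode (Q, N)) (fm_code \<phi>)) \<longleftrightarrow> q \<in> dfa_final (fm_dfa \<phi>)"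
  using assms
proof (induction \<phi> arbitrary: q)
  case (Eq s t)
  \<comment> \<open>The only final state is \<open>Suc (int_encode 0)\<close>, which is 1, and 2 is
    the code of the set containing just 1.\<close>
  have "set_decode 2 = dfa_final (eq_dfa s t)"
    using set_encode_inverse[of "{Suc 0}"] by (simp add: eq_dfa_simps int_encode_def sum_encode_def)
  then show ?case by (simp add: final_code_def course_def)
next
  case (Neg \<phi>)
  have "q \<le> Q" using states_le_bound Neg.prems le_trans by blast
  moreover have "fm_code \<phi> \<le> N"
    using Neg.prems(1) subformula_le(1) le_trans by blast
  moreover have "final_code (prod_encode (Q, N)) (fm_code (Neg \<phi>)) =
      set_encode {q. q < Suc Q \<and> q \<notin> set_decode (final_code (prod_encode (Q, N)) (fm_code \<phi>))}"
    by (simp add: final_code_def course_def[of _ _ "prod_encode (1, _)"] course_def[of _ _ "prod_encode (Suc 0, _)"]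
        lookup_course_table code_components_less)
  ultimately show ?case
    using Neg.IH[of q] Neg.prems unfolding state_bound_code by (auto simp: neg_dfa_def)
next
  case (Conj \<phi> \<psi>)
  have q: "q \<le> Q" using states_le_bound Conj.prems le_trans by blast
  have N: "fm_code \<phi> \<le> N" "fm_code \<psi> \<le> N"
    using Conj.prems(1) subformula_le(2,3) le_trans by blast+
  have Q: "state_bound (fm_code \<phi>) \<le> Q" "state_bound (fm_code \<psi>) \<le> Q"
    using Conj.prems(2) state_bound_subformula_le(1,2) le_trans by blast+
  obtain q1 q2 where q12: "q = prod_encode (q1, q2)" "q1 \<in> dfa_states (fm_dfa \<phi>)" "q2 \<in> dfa_states (fm_dfa \<psi>)"
    using Conj.prems(3) by (auto simp: conj_dfa_def)
  have "final_code (prod_encode (Q, N)) (fm_code (Conj \<phi> \<psi>)) = set_encode {q. q < Suc Q \<and>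
      pfst q \<in> set_decode (final_code (prod_encode (Q, N)) (fm_code \<phi>)) \<and>
      psnd q \<in> set_decode (final_code (prod_encode (Q, N)) (fm_code \<psi>))}"
    by (simp add: final_code_def course_def[of _ _ "prod_encode (2, _)"]
        lookup_course_table code_components_less)
  then show ?case
    using Conj.IH(1)[OF N(1) Q(1) q12(2)] Conj.IH(2)[OF N(2) Q(2) q12(3)] q
    by (auto simp: q12(1) conj_dfa_def)
next
  case (Ex x \<phi>)
  let ?A = "fm_dfa \<phi>" and ?b = "prod_encode (Q, N)"
  have q: "q \<le> Q" using states_le_bound Ex.prems le_trans by blast
  have N: "x \<le> N" "fm_code \<phi> \<le> N"
    using Ex.prems(1) subformula_le(4,5) le_trans by blast+
  have Q: "state_bound (fm_code \<phi>) \<le> Q"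
    using Ex.prems(2) state_bound_subformula_le(3) le_trans by blast
  obtain S where S: "q = set_encode S" "S \<subseteq> dfa_states ?A"
    using Ex.prems(3) by (auto simp: ex_dfa_def)
  have fin: "finite (dfa_states ?A)" using finite_dfa_fm by (auto simp: finite_dfa_def)
  then have dec_q: "set_decode q = S" using S by (simp add: finite_subset)
  have less_Q: "p < Suc Q" if "p \<in> dfa_states ?A" for p
    using states_le_bound[OF that] Q by simp
  have N01: "next_code ?b (fm_code \<phi>) p 0 = dfa_next ?A p {}"
    "next_code ?b (fm_code \<phi>) p (2 ^ x) = dfa_next ?A p {x}" if "p \<in> dfa_states ?A" for p
  proof -
    have "(2 :: nat) ^ x < 2 ^ Suc N" using N(1) by (intro power_strict_increasing) auto
    moreover have "set_decode (2 ^ x) = {x}" using set_encode_inverse[of "{x}"] by simp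
    ultimately show "next_code ?b (fm_code \<phi>) p 0 = dfa_next ?A p {}"
      "next_code ?b (fm_code \<phi>) p (2 ^ x) = dfa_next ?A p {x}"
      using next_code_eq[OF N(2) Q that, of 0] next_code_eq[OF N(2) Q that, of "2 ^ x"] by simp_all
  qed
  let ?reach = "\<lambda>p. \<forall>T<2 ^ Suc Q. p \<in> set_decode T \<and>
    (\<forall>r<Suc Q. r \<in> set_decode T \<longrightarrow> next_code ?b (fm_code \<phi>) r 0 \<in> set_decode T \<and>
      next_code ?b (fm_code \<phi>) r (2 ^ x) \<in> set_decode T) \<longrightarrow>
    (\<exists>r<Suc Q. r \<in> set_decode T \<and> r \<in> set_decode (final_code ?b (fm_code \<phi>)))"
  have eq: "?reach p \<longleftrightarrow> (\<exists>u \<in> lists {{}, {x}}. last (run_from ?A p u) \<in> dfa_final ?A)"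
    if "p \<in> dfa_states ?A" for p
    by (rule reachable_iff_closed_sets[symmetric]) (rule that less_Q N01 Ex.IH[OF N(2) Q]; assumption)+
  have "final_code ?b (fm_code (Ex x \<phi>)) =
      set_encode {S. S < Suc Q \<and> (\<exists>p<Suc Q. p \<in> set_decode S \<and> ?reach p)}"
    by (simp add: final_code_def course_def[of _ _ "prod_encode (3, _)"]
        lookup_course_table code_components_less del: power_Suc)
  then have "q \<in> set_decode (final_code ?b (fm_code (Ex x \<phi>))) \<longleftrightarrow> (\<exists>p<Suc Q. p \<in> S \<and> ?reach p)"
    using q dec_q by (simp del: power_Suc)
  also have "\<dots> \<longleftrightarrow> (\<exists>p\<in>S. ?reach p)" using less_Q S(2) by blast
  also have "\<dots> \<longleftrightarrow> (\<exists>p\<in>S. \<exists>u \<in> lists {{}, {x}}. last (run_from ?A p u) \<in> dfa_final ?A)"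
    using S(2) by (intro bex_cong refl eq) (rule subsetD)
  also have "\<dots> \<longleftrightarrow> q \<in> dfa_final (fm_dfa (Ex x \<phi>))"
    using S finite_subset[OF _ fin] by (auto simp: ex_dfa_def set_encode_eq)
  finally show ?case .
qed


section \<open>The Presburger domain\<close>

text \<open>The code of a formula also bounds its variables, quantified ones included.\<close>

definition bounds_code :: "nat \<Rightarrow> nat" where
  "bounds_code p = prod_encode (state_bound p, p)"

definition true_code :: "nat \<Rightarrow> bool" where
  "true_code p \<longleftrightarrow> init_code p \<in> set_decode (final_code (bounds_code p) p)"

text \<open>The letter code 0 is the empty letter, the only one that occurs in words for a
  sentence.\<close>

definition run_code :: "nat \<Rightarrow> nat \<Rightarrow> bool" where
  "run_code p w \<longleftrightarrow> 0 < length (list_decode w) \<and> code_nth w 0 = init_code p \<and>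
     (\<forall>i<length (list_decode w) - 1.
        code_nth w (Suc i) = next_code (bounds_code p) p (code_nth w i) 0)"

lemma computable_true_code [computable_intro]:
  "computable f \<Longrightarrow> decidable_pred (\<lambda>x. true_code (f x))"
  unfolding true_code_def bounds_code_def by (intro computable_intro)

lemma computable_run_code [computable_intro]:
  assumes "computable f" "computable g"
  shows "decidable_pred (\<lambda>x. run_code (f x) (g x))"
  unfolding run_code_def bounds_code_def
  by (intro computable_intro assms computable_comp[of f] computable_comp[of g])

text \<open>A sentence has the same truth value under all valuations, so the verdict is the same for
  every word. A run is therefore accepting or rejecting according to truth alone, and its last state
  does not have to be inspected.\<close>

lemma sentence_dfa_accepts:
  assumes "sentence \<phi>"
  shows "dfa_accepts (fm_dfa \<phi>) u \<longleftrightarrow> true_in_nat \<phi>"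
  using assms sat_cong[of \<phi>] unfolding fm_dfa_accepts true_in_nat_def sentence_def by blast

lemma true_code_iff:
  assumes "sentence \<phi>"
  shows "true_code (fm_code \<phi>) \<longleftrightarrow> true_in_nat \<phi>"
proof -
  have "true_code (fm_code \<phi>) \<longleftrightarrow> dfa_accepts (fm_dfa \<phi>) []"
    unfolding true_code_def bounds_code_def init_code_eq dfa_accepts_iff
    by (simp add: final_code_eq fm_dfa_init_in_states)
  then show ?thesis using sentence_dfa_accepts[OF assms] by simp
qed

text \<open>Over a single letter a run is determined by its length, so it is recognised by its first
  state and its successive transitions.\<close>

lemma run_from_replicate_iff:
  "(\<exists>n. xs = run_from A q (replicate n a)) \<longleftrightarrow>
    xs \<noteq> [] \<and> xs ! 0 = q \<and> (\<forall>i<length xs - 1. xs ! Suc i = dfa_next A (xs ! i) a)"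
proof (induction xs arbitrary: q)
  case Nil
  have "run_from A q u \<noteq> []" for u by (cases u) auto
  then show ?case by (metis)
next
  case (Cons y ys)
  have "(\<exists>n. y # ys = run_from A q (replicate n a)) \<longleftrightarrow>
      y = q \<and> (ys = [] \<or> (\<exists>n. ys = run_from A (dfa_next A q a) (replicate n a)))"
  proof
    assume "\<exists>n. y # ys = run_from A q (replicate n a)"
    then obtain n where "y # ys = run_from A q (replicate n a)" ..
    then show "y = q \<and> (ys = [] \<or> (\<exists>n. ys = run_from A (dfa_next A q a) (replicate n a)))"
      by (cases n) auto
  next
    assume "y = q \<and> (ys = [] \<or> (\<exists>n. ys = run_from A (dfa_next A q a) (replicate n a)))"
    then show "\<exists>n. y # ys = run_from A q (replicate n a)"
      by (metis replicate_0 replicate_Suc run_from.simps)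
  qed
  also have "\<dots> \<longleftrightarrow> y = q \<and> (\<forall>i<length ys. (y # ys) ! Suc i = dfa_next A ((y # ys) ! i) a)"
    unfolding Cons.IH by (cases ys) (auto simp: All_less_Suc2)
  finally show ?case by auto
qed

lemma run_code_iff:
  assumes "sentence \<phi>"
  shows "run_code (fm_code \<phi>) w \<longleftrightarrow>
    (\<exists>u \<in> lists (Pow (free_vars \<phi>)). w = list_encode (dfa_run (fm_dfa \<phi>) u))"
proof -
  let ?A = "fm_dfa \<phi>"
  define xs where "xs = list_decode w"
  have w: "w = list_encode xs" by (simp add: xs_def)
  have "(\<exists>u \<in> lists (Pow (free_vars \<phi>)). w = list_encode (dfa_run ?A u)) \<longleftrightarrow>
      (\<exists>n. xs = run_from ?A (dfa_init ?A) (replicate n {}))"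
  proof -
    have "lists (Pow (free_vars \<phi>)) = range (\<lambda>n. replicate n {})"
    proof (intro equalityI subsetI)
      fix u assume "u \<in> lists (Pow (free_vars \<phi>))"
      then have "u = replicate (length u) {}"
        using assms by (intro replicate_eqI) (auto simp: sentence_def)
      then show "u \<in> range (\<lambda>n. replicate n {})" by (rule range_eqI)
    qed auto
    then show ?thesis by (simp add: w dfa_run_def list_encode_eq)
  qed
  also have "\<dots> \<longleftrightarrow> xs \<noteq> [] \<and> xs ! 0 = dfa_init ?A \<and>
      (\<forall>i<length xs - 1. xs ! Suc i = dfa_next ?A (xs ! i) {})"
    by (rule run_from_replicate_iff)
  also have "\<dots> \<longleftrightarrow> xs \<noteq> [] \<and> xs ! 0 = dfa_init ?A \<and>
      (\<forall>i<length xs - 1. xs ! Suc i = next_code (bounds_code (fm_code \<phi>)) (fm_code \<phi>) (xs ! i) 0)"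
    (is "?run \<longleftrightarrow> ?run'")
  proof -
    have eq: "next_code (bounds_code (fm_code \<phi>)) (fm_code \<phi>) q 0 = dfa_next ?A q {}"
      if "q \<in> dfa_states ?A" for q
      unfolding bounds_code_def using next_code_eq[OF le_refl le_refl that, of 0] by simp
    \<comment> \<open>\<open>next_code\<close> is known to agree with the automaton on states only.
      That all entries are states follows by induction along the list, whichever of the two
      transition functions is assumed.\<close>
    have "xs ! i \<in> dfa_states ?A" if "?run \<or> ?run'" "i < length xs" for i
      using that(2)
    proof (induction i)
      case 0
      then show ?case using that(1) fm_dfa_init_in_states by auto
    next
      case (Suc i)
      then have "xs ! Suc i = dfa_next ?A (xs ! i) {}" using that(1) eq by auto
      then show ?case using Suc fm_dfa_next_in_states[OF finite_dfa_fm] by auto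
    qed
    with eq show ?thesis by auto
  qed
  also have "\<dots> \<longleftrightarrow> run_code (fm_code \<phi>) w"
    unfolding run_code_def init_code_eq w by (auto simp: code_nth_list_encode)
  finally show ?thesis by blast
qed

lemma presburger_codes:
  assumes "sentence \<phi>"
  shows "fm_code \<phi> \<in> manifest presburger_domain \<longleftrightarrow> true_in_nat \<phi>"
    and "accepting_run (fm_code \<phi>) w \<longleftrightarrow> true_code (fm_code \<phi>) \<and> run_code (fm_code \<phi>) w"
    and "rejecting_run (fm_code \<phi>) w \<longleftrightarrow> \<not> true_code (fm_code \<phi>) \<and> run_code (fm_code \<phi>) w"
  unfolding accepting_run_def rejecting_run_def presburger_domain_def run_code_iff[OF assms]
    true_code_iff[OF assms]
  using assms sentence_dfa_accepts by auto

lemma ex_run_code: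
  assumes "sentence \<phi>"
  shows "\<exists>w. run_code (fm_code \<phi>) w"
  unfolding run_code_iff[OF assms] by (auto intro!: exI bexI[of _ "[]"])

lemma presburger_distinctions: "p \<in> distinctions presburger_domain \<longleftrightarrow> (\<exists>\<phi>. sentence \<phi> \<and> p = fm_code \<phi>)"
  by (auto simp: presburger_domain_def)

lemma decidable_presburger: "decidable_domain presburger_domain"
proof -
  have "p \<in> {p \<in> distinctions presburger_domain. p \<in> manifest presburger_domain} \<longleftrightarrow>
      sentence_code p \<and> true_code p" for p
    unfolding mem_Collect_eq presburger_distinctions sentence_code_iff
    using presburger_codes(1) true_code_iff by auto
  then show ?thesis
    unfolding decidable_domain_def decidable_set_iff by (simp only:) (intro computable_intro)
qed

lemma presburger_certifying_decision:
  "certifying_decision presburger_domain accepting_run rejecting_run"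
proof -
  let ?D = "distinctions presburger_domain" and ?M = "manifest presburger_domain"
  let ?Acc = "\<lambda>p w. true_code p \<and> run_code p w" and ?Rej = "\<lambda>p w. \<not> true_code p \<and> run_code p w"
  have runs: "accepting_run p w \<longleftrightarrow> ?Acc p w" "rejecting_run p w \<longleftrightarrow> ?Rej p w" if "p \<in> ?D" for p w
    using that presburger_codes(2,3) unfolding presburger_distinctions by auto
  have man: "p \<in> ?M \<longleftrightarrow> true_code p" and ex: "\<exists>w. run_code p w" if "p \<in> ?D" for p
    using that presburger_codes(1) true_code_iff ex_run_code unfolding presburger_distinctions by auto
  have rec: "decidable_pred (\<lambda>z. run_code (pfst z) (psnd z))" by (intro computable_intro)
  obtain W where W: "computable_on ?D (\<lambda>p. Some (W p))" "\<And>p. p \<in> ?D \<Longrightarrow> run_code p (W p)"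
    using computable_on_search[of run_code ?D, OF rec ex] by blast
  have "computable_rel_on ?D accepting_run"
    by (rule computable_rel_onI[of ?Acc]) (intro computable_intro, rule runs)
  moreover have "computable_rel_on ?D rejecting_run"
    by (rule computable_rel_onI[of ?Rej]) (intro computable_intro, rule runs)
  moreover have "(\<exists>w. accepting_run p w) \<longleftrightarrow> true_code p" "(\<exists>w. rejecting_run p w) \<longleftrightarrow> \<not> true_code p"
    if "p \<in> ?D" for p
    using runs[OF that] ex[OF that] by blast+
  moreover have "if p \<in> ?M then accepting_run p (W p) else rejecting_run p (W p)" if "p \<in> ?D" for p
    using runs[OF that] man[OF that] W(2)[OF that] by simp
  ultimately show ?thesis
    unfolding certifying_decision_def using man W(1) by blast
qed

lemma presburger_certificate_scheme: "certificate_scheme presburger_domain rejecting_run"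
proof (rule certificate_schemeI[where Q = "\<lambda>p w. \<not> true_code p \<and> run_code p w"])
  show "decidable_pred (\<lambda>z. \<not> true_code (pfst z) \<and> run_code (pfst z) (psnd z))"
    by (intro computable_intro)
qed (use presburger_codes true_code_iff ex_run_code presburger_distinctions in auto)


section \<open>Ultimate periodicity\<close>

lemma step_in_state_space: "reentry_system S \<Longrightarrow> step S s \<in> state_space S"
  by (simp add: step_def state_space_def dimension_def)

lemma evolution_in_state_space: "reentry_system S \<Longrightarrow> evolution S t \<in> state_space S"
  by (cases t) (simp_all add: evolution_def step_in_state_space, simp add: state_space_def reentry_system_def)

lemma finite_state_space: "finite (state_space S)"
  and card_state_space: "card (state_space S) = 2 ^ dimension S"
  using finite_lists_length_eq[of "UNIV :: bool set" "dimension S"]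
    card_lists_length_eq[of "UNIV :: bool set" "dimension S"]
  by (simp_all add: state_space_def)

lemma evolution_Suc: "evolution S (Suc t) = step S (evolution S t)"
  by (simp add: evolution_def)

lemma evolution_shift: "evolution S t = evolution S t' \<Longrightarrow> evolution S (t + k) = evolution S (t' + k)"
  by (induction k) (auto simp: evolution_Suc)

text \<open>The evolution is deterministic, so one return to the state at time \<open>m\<close>
  repeats forever.\<close>

lemma periodic_from_iff:
  "periodic_from (evolution S) m k \<longleftrightarrow> 0 < k \<and> evolution S (m + k) = evolution S m"
proof
  assume *: "0 < k \<and> evolution S (m + k) = evolution S m"
  have "evolution S (t + k) = evolution S t" if "m \<le> t" for t
    using evolution_shift[of S "m + k" m "t - m"] * that by (simp add: ac_simps)
  with * show "periodic_from (evolution S) m k" by (simp add: periodic_from_def)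
qed (auto simp: periodic_from_def)

text \<open>
  Before time \<open>transient + period\<close> no state repeats, for a repetition would make the orbit periodic
  either too early or with too small a period.
\<close>

lemma transient_period:
  assumes "reentry_system S"
  shows "periodic_from (evolution S) (transient S) (period S)"
    and "transient S + period S \<le> 2 ^ dimension S"
    and "behaviour S t \<Longrightarrow> \<exists>t'<transient S + period S. behaviour S t'"
proof -
  let ?m = "transient S" and ?k = "period S"
  have "\<not> inj (evolution S)"
  proof
    assume "inj (evolution S)"
    then have "infinite (range (evolution S))" by (simp add: finite_image_iff)
    moreover have "range (evolution S) \<subseteq> state_space S" using evolution_in_state_space[OF assms] by blast
    ultimately show False using finite_state_space finite_subset by blast
  qed
  then obtain a b where "a < b" "evolution S a = evolution S b"
    unfolding inj_def by (metis linorder_neqE_nat)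
  then have "\<exists>k. periodic_from (evolution S) a k"
    by (intro exI[of _ "b - a"]) (simp add: periodic_from_iff)
  then have "\<exists>k. periodic_from (evolution S) ?m k"
    unfolding transient_def by (rule LeastI[of "\<lambda>m. \<exists>k. periodic_from (evolution S) m k"])
  then show per: "periodic_from (evolution S) ?m ?k"
    unfolding period_def by (rule LeastI_ex)
  then have k: "0 < ?k" and *: "evolution S (t + ?k) = evolution S t" if "?m \<le> t" for t
    using that by (auto simp: periodic_from_def)
  have least: "?m \<le> i" "i = ?m \<Longrightarrow> ?k \<le> j - i" if "i < j" "evolution S i = evolution S j" for i j
  proof -
    have "periodic_from (evolution S) i (j - i)" using that by (simp add: periodic_from_iff)
    then show "?m \<le> i" "i = ?m \<Longrightarrow> ?k \<le> j - i"
      unfolding transient_def period_def by (auto intro!: Least_le)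
  qed
  have "inj_on (evolution S) {..<?m + ?k}"
  proof (rule linorder_inj_onI)
    fix i j assume ij: "i < j" "j \<in> {..<?m + ?k}"
    show "evolution S i \<noteq> evolution S j"
    proof
      assume eq: "evolution S i = evolution S j"
      then have "?m \<le> i" using least(1) ij(1) by blast
      \<comment> \<open>Shifting by \<open>l\<close> takes time \<open>i\<close> to
        \<open>?m + ?k\<close>, where the state at \<open>?m\<close> is back. The repetition becomes
        a return to that state after \<open>j - i\<close> steps, which are fewer than
        \<open>?k\<close>.\<close>
      define l where "l = ?m + ?k - i"
      have "evolution S (j + l) = evolution S (i + l)" using evolution_shift[OF eq] by simp
      moreover have "i + l = ?m + ?k" using ij \<open>?m \<le> i\<close> by (simp add: l_def)
      moreover have "j + l = ?m + (j - i) + ?k" using ij \<open>?m \<le> i\<close> by (simp add: l_def)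
      ultimately have "evolution S (?m + (j - i)) = evolution S ?m"
        using *[of ?m] *[of "?m + (j - i)"] by simp
      then have "?k \<le> j - i" using least(2)[of ?m "?m + (j - i)"] ij(1) by simp
      then show False using ij \<open>?m \<le> i\<close> by simp
    qed
  qed auto
  then have "card (evolution S ` {..<?m + ?k}) = ?m + ?k" by (simp add: card_image)
  moreover have "card (evolution S ` {..<?m + ?k}) \<le> card (state_space S)"
    using evolution_in_state_space[OF assms] by (intro card_mono finite_state_space) auto
  ultimately show "?m + ?k \<le> 2 ^ dimension S" by (simp add: card_state_space)
  \<comment> \<open>A mark beyond the first cycle also occurs one period earlier.\<close>
  show "\<exists>t'<?m + ?k. behaviour S t'" if "behaviour S t"
    using that
  proof (induction t rule: less_induct)
    case (less t)
    show ?case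
    proof (cases "t < ?m + ?k")
      case False
      then have "evolution S (t - ?k) = evolution S t" using *[of "t - ?k"] by simp
      then have "behaviour S (t - ?k)" using less.prems by (simp add: behaviour_def)
      moreover have "t - ?k < t" using k[of ?m] False by simp
      ultimately show ?thesis using less.IH by blast
    qed (use less.prems in blast)
  qed
qed


section \<open>Codes of systems\<close>

lemma expr_code_eq_iff [simp]: "expr_code a = expr_code b \<longleftrightarrow> a = b"
proof
  show "expr_code a = expr_code b \<Longrightarrow> a = b"
    by (induction a arbitrary: b) (case_tac b; auto)+
qed simp

lemma system_code_eq_iff [simp]: "system_code S = system_code T \<longleftrightarrow> S = T"
proof
  have "inj (map expr_code)" "inj (map (of_bool :: bool \<Rightarrow> nat))"
    by (auto intro!: inj_mapI injI simp: of_bool_def split: if_splits)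
  then show "system_code S = system_code T \<Longrightarrow> S = T"
    by (cases S, cases T) (auto simp: system_code_def list_encode_eq inj_def)
qed simp

lemma ex_expr_iff:
  "(\<exists>a. P a) \<longleftrightarrow> P Void \<or> (\<exists>i. P (SVar i)) \<or> (\<exists>a. P (Cross a)) \<or> (\<exists>a b. P (Juxt a b))"
  by (metis expr.exhaust)

text \<open>Being a code and using only existing state variables are tested in one
  recursion.\<close>

definition expr_code_below :: "nat \<Rightarrow> nat \<Rightarrow> bool" where
  "expr_code_below n x \<longleftrightarrow> (\<exists>a. x = expr_code a \<and> expr_vars a \<subseteq> {..<n})"

lemma expr_code_below_iff:
  "expr_code_below n x \<longleftrightarrow> pfst x = 0 \<and> psnd x = 0 \<or> pfst x = 1 \<and> psnd x < n \<or>
    pfst x = 2 \<and> expr_code_below n (psnd x) \<or>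
    pfst x = 3 \<and> expr_code_below n (pfst (psnd x)) \<and> expr_code_below n (psnd (psnd x))"
  unfolding expr_code_below_def
  by (simp add: ex_expr_iff[of "\<lambda>a. x = expr_code a \<and> expr_vars a \<subseteq> {..<n}"] prod_encode_eq_iff
      del: One_nat_def) blast

lemma computable_expr_code_below [computable_intro]:
  assumes "computable n" "computable x"
  shows "decidable_pred (\<lambda>z. expr_code_below (n z) (x z))"
proof (rule computable_courseI[where f = "\<lambda>n x. of_bool (expr_code_below n x)"
      and G = "\<lambda>n x h. of_bool (pfst x = 0 \<and> psnd x = 0 \<or> pfst x = 1 \<and> psnd x < n \<or>
        pfst x = 2 \<and> lookup x h (psnd x) = 1 \<or>
        pfst x = 3 \<and> lookup x h (pfst (psnd x)) = 1 \<and> lookup x h (psnd (psnd x)) = 1)"])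
  let ?h = "\<lambda>n x. table (\<lambda>x. of_bool (expr_code_below n x)) x"
  show "of_bool (expr_code_below n x) = of_bool (pfst x = 0 \<and> psnd x = 0 \<or> pfst x = 1 \<and> psnd x < n \<or>
      pfst x = 2 \<and> lookup x (?h n x) (psnd x) = 1 \<or>
      pfst x = 3 \<and> lookup x (?h n x) (pfst (psnd x)) = 1 \<and> lookup x (?h n x) (psnd (psnd x)) = 1)" for n x
    by (subst expr_code_below_iff) (simp add: lookup_table components_less cong: conj_cong)
qed (intro computable_intro assms)+

section \<open>Running a system on its code\<close>

definition expr_eval :: "nat \<Rightarrow> nat \<Rightarrow> nat" where
  "expr_eval = course (\<lambda>s x h.
     if pfst x = 0 then 0
     else if pfst x = 1 then code_nth s (psnd x)
     else if pfst x = 2 then 1 - lookup x h (psnd x)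
     else of_bool (lookup x h (pfst (psnd x)) = 1 \<or> lookup x h (psnd (psnd x)) = 1))"

abbreviation state_code :: "bool list \<Rightarrow> nat" where
  "state_code s \<equiv> list_encode (map of_bool s)"

lemma expr_eval_code:
  "expr_vars a \<subseteq> {..<length s} \<Longrightarrow> expr_eval (state_code s) (expr_code a) = of_bool (expr_val s a)"
  by (induction a)
    (simp_all add: expr_eval_def course_def[of _ _ "prod_encode _"] lookup_course_table
      code_components_less code_nth_list_encode)

lemma computable_expr_eval [computable_intro]:
  "computable s \<Longrightarrow> computable x \<Longrightarrow> computable (\<lambda>z. expr_eval (s z) (x z))"
  unfolding expr_eval_def by (rule computable_course) (intro computable_intro)

definition evolution_code :: "nat \<Rightarrow> nat \<Rightarrow> nat" where
  "evolution_code p t = rec_nat (pfst (psnd p))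
     (\<lambda>_ s. list_encode (map (expr_eval s) (list_decode (pfst p)))) t"

lemma computable_evolution_code [computable_intro]:
  assumes "computable p" "computable t"
  shows "computable (\<lambda>z. evolution_code (p z) (t z))"
  unfolding evolution_code_def
  by (intro computable_intro assms computable_comp[of p])

lemma evolution_code_eq:
  assumes "reentry_system S"
  shows "evolution_code (system_code S) t = state_code (evolution S t)"
proof (induction t)
  case 0
  show ?case by (simp add: evolution_code_def system_code_def evolution_def)
next
  case (Suc t)
  have "length (evolution S t) = dimension S"
    using evolution_in_state_space[OF assms] by (simp add: state_space_def)
  then have "map (expr_eval (state_code (evolution S t))) (map expr_code (updates S)) =
      map of_bool (step S (evolution S t))"
    using assms by (auto simp: step_def reentry_system_def expr_eval_code)
  moreover have "evolution_code (system_code S) (Suc t) =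
      list_encode (map (expr_eval (evolution_code (system_code S) t)) (map expr_code (updates S)))"
    by (simp add: evolution_code_def system_code_def del: map_map)
  ultimately show ?case using Suc by (simp add: evolution_Suc)
qed

lemma state_code_eq_iff [simp]: "state_code s = state_code t \<longleftrightarrow> s = t"
  by (simp add: list_encode_eq inj_map_eq_map inj_def)

definition behaviour_code :: "nat \<Rightarrow> nat \<Rightarrow> bool" where
  "behaviour_code p t \<longleftrightarrow> code_nth (evolution_code p t) (psnd (psnd p)) = 1"

lemma computable_behaviour_code [computable_intro]:
  assumes "computable p" "computable t"
  shows "decidable_pred (\<lambda>z. behaviour_code (p z) (t z))"
  unfolding behaviour_code_def by (intro computable_intro assms)

lemma behaviour_code_eq:
  assumes "reentry_system S"
  shows "behaviour_code (system_code S) t \<longleftrightarrow> behaviour S t"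
proof -
  have "observed S < length (evolution S t)"
    using assms evolution_in_state_space[OF assms, of t] by (simp add: reentry_system_def state_space_def)
  then show ?thesis
    by (simp add: behaviour_code_def evolution_code_eq[OF assms] behaviour_def code_nth_list_encode)
      (simp add: system_code_def code_nth_list_encode)
qed

section \<open>Recognising codes of systems\<close>

definition dimension_code :: "nat \<Rightarrow> nat" where
  "dimension_code p = length (list_decode (pfst p))"

lemma dimension_code_eq: "dimension_code (system_code S) = dimension S"
  by (simp add: dimension_code_def system_code_def dimension_def)

lemma computable_dimension_code [computable_intro]:
  "computable p \<Longrightarrow> computable (\<lambda>z. dimension_code (p z))"
  unfolding dimension_code_def by (intro computable_intro)

definition reentry_code :: "nat \<Rightarrow> bool" where
  "reentry_code p \<longleftrightarrow>
     length (list_decode (pfst (psnd p))) = dimension_code p \<and> psnd (psnd p) < dimension_code p \<and>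
     (\<forall>i<dimension_code p. expr_code_below (dimension_code p) (code_nth (pfst p) i) \<and>
       code_nth (pfst (psnd p)) i \<le> 1)"

lemma computable_reentry_code [computable_intro]:
  assumes "computable p"
  shows "decidable_pred (\<lambda>z. reentry_code (p z))"
  unfolding reentry_code_def by (intro computable_intro assms computable_comp[of p])

lemma reentry_code_iff: "reentry_code p \<longleftrightarrow> (\<exists>S. reentry_system S \<and> p = system_code S)"
proof
  assume *: "reentry_code p"
  define us bs n where "us = list_decode (pfst p)" and "bs = list_decode (pfst (psnd p))"
    and "n = dimension_code p"
  have p: "pfst p = list_encode us" "pfst (psnd p) = list_encode bs"
    by (simp_all add: us_def bs_def)
  have n: "length us = n" "length bs = n" "psnd (psnd p) < n"
    using * by (simp_all add: us_def bs_def n_def reentry_code_def dimension_code_def)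
  have "expr_code_below n (us ! i) \<and> bs ! i \<le> 1" if "i < n" for i
    using * that unfolding reentry_code_def n_def[symmetric] p by (simp add: code_nth_list_encode n)
  then have "\<forall>u\<in>set us. expr_code_below n u" "\<forall>b\<in>set bs. b \<le> 1"
    by (auto simp: in_set_conv_nth n)
  then have "\<forall>u. \<exists>a. u \<in> set us \<longrightarrow> u = expr_code a \<and> expr_vars a \<subseteq> {..<n}"
    by (auto simp: expr_code_below_def)
  then obtain e where e: "\<And>u. u \<in> set us \<Longrightarrow> u = expr_code (e u) \<and> expr_vars (e u) \<subseteq> {..<n}"
    by metis
  \<comment> \<open>Entries of \<open>bs\<close> are at most 1, so comparison with 1 inverts
    \<open>of_bool\<close>.\<close>
  define S where "S = \<lparr>updates = map e us, initial = map (\<lambda>b. b = 1) bs, observed = psnd (psnd p)\<rparr>"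
  have "reentry_system S"
    using n e by (auto simp: S_def reentry_system_def dimension_def)
  moreover have "map expr_code (updates S) = us"
    using e by (auto simp: S_def intro!: map_idI)
  moreover have "map of_bool (initial S) = bs"
    using \<open>\<forall>b\<in>set bs. b \<le> 1\<close> by (auto simp: S_def le_Suc_eq intro!: map_idI)
  ultimately show "\<exists>S. reentry_system S \<and> p = system_code S"
    by (intro exI[of _ S]) (simp add: system_code_def p(1,2)[symmetric] S_def)
next
  assume "\<exists>S. reentry_system S \<and> p = system_code S"
  then obtain S where S: "reentry_system S" "p = system_code S" by blast
  then have "expr_code_below (dimension S) (expr_code a)" if "a \<in> set (updates S)" for a
    using that by (auto simp: expr_code_below_def reentry_system_def)
  then show "reentry_code p"
    using S(1) unfolding reentry_code_def S(2) dimension_code_eq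
    by (auto simp: system_code_def reentry_system_def dimension_def code_nth_list_encode)
qed


section \<open>The re-entry domain\<close>

lemma reentry_manifest:
  assumes "reentry_system S"
  shows "system_code S \<in> manifest reentry_domain \<longleftrightarrow> system_manifests S"
  using assms by (auto simp: reentry_domain_def)

lemma reentry_distinctions: "p \<in> distinctions reentry_domain \<longleftrightarrow> (\<exists>S. reentry_system S \<and> p = system_code S)"
  by (auto simp: reentry_domain_def)

text \<open>Any bound beyond the first cycle will do: decidability uses the computable
  \<open>2 ^ n\<close>, the certificate the exact length of prefix and cycle.\<close>

lemma system_manifests_iff:
  assumes "reentry_system S" "transient S + period S \<le> b"
  shows "system_manifests S \<longleftrightarrow> (\<exists>t<b. behaviour S t)"
  using transient_period(3)[OF assms(1)] assms(2) unfolding system_manifests_def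
  by (meson less_le_trans)

lemma decidable_reentry: "decidable_domain reentry_domain"
proof -
  have "p \<in> {p \<in> distinctions reentry_domain. p \<in> manifest reentry_domain} \<longleftrightarrow>
      reentry_code p \<and> (\<exists>t<2 ^ dimension_code p. behaviour_code p t)" for p
    unfolding mem_Collect_eq reentry_distinctions reentry_code_iff
    by (auto simp: reentry_manifest system_manifests_iff[OF _ transient_period(2)] behaviour_code_eq
        dimension_code_eq)
  then show ?thesis
    unfolding decidable_domain_def decidable_set_iff by (simp only:) (intro computable_intro)
qed

text \<open>By \<open>periodic_from_iff\<close> this equality of two states expresses periodicity
  from \<open>m\<close>, which by definition concerns all later times.\<close>

definition returns_code :: "nat \<Rightarrow> nat \<Rightarrow> nat \<Rightarrow> bool" where
  "returns_code p m k \<longleftrightarrow> 0 < k \<and> evolution_code p (m + k) = evolution_code p m"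

text \<open>Only periods up to \<open>2 ^ n\<close> have to be ruled out at times \<open>m\<close> before the transient, since the
  true period is that small.\<close>

definition mark_free_code :: "nat \<Rightarrow> nat \<Rightarrow> bool" where
  "mark_free_code p w \<longleftrightarrow> returns_code p (pfst w) (psnd w) \<and>
     (\<forall>m<pfst w. \<forall>k<Suc (2 ^ dimension_code p). \<not> returns_code p m k) \<and>
     (\<forall>k<psnd w. \<not> returns_code p (pfst w) k) \<and>
     (\<forall>t<pfst w + psnd w. \<not> behaviour_code p t)"

lemma computable_returns_code [computable_intro]:
  assumes "computable p" "computable m" "computable k"
  shows "decidable_pred (\<lambda>z. returns_code (p z) (m z) (k z))"
  unfolding returns_code_def by (intro computable_intro assms)

lemma computable_mark_free_code: "decidable_pred (\<lambda>z. mark_free_code (pfst z) (psnd z))"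
  unfolding mark_free_code_def by (intro computable_intro)

lemma returns_code_iff:
  "reentry_system S \<Longrightarrow> returns_code (system_code S) m k \<longleftrightarrow> periodic_from (evolution S) m k"
  by (simp add: returns_code_def evolution_code_eq periodic_from_iff)

lemma transient_period_unique:
  assumes S: "reentry_system S" and "periodic_from (evolution S) m k"
    and "\<forall>m'<m. \<forall>k'<Suc (2 ^ dimension S). \<not> periodic_from (evolution S) m' k'"
    and "\<forall>k'<k. \<not> periodic_from (evolution S) m k'"
  shows "m = transient S \<and> k = period S"
proof -
  note per = transient_period(1)[OF S]
  have "transient S \<le> m"
    unfolding transient_def using assms(2) by (blast intro: Least_le)
  moreover have "period S < Suc (2 ^ dimension S)" using transient_period(2)[OF S] by simp
  then have "\<not> transient S < m" using assms(3) per by blast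
  ultimately have m: "m = transient S" by simp
  have "period S \<le> k"
    unfolding period_def using assms(2) m by (blast intro: Least_le)
  moreover have "\<not> period S < k" using assms(4) per m by blast
  ultimately show ?thesis using m by simp
qed

lemma not_periodic_before:
  "m < transient S \<Longrightarrow> \<not> periodic_from (evolution S) m k"
  "k < period S \<Longrightarrow> \<not> periodic_from (evolution S) (transient S) k"
  using not_less_Least[of m "\<lambda>m. \<exists>k. periodic_from (evolution S) m k"]
    not_less_Least[of k "periodic_from (evolution S) (transient S)"]
  unfolding transient_def[symmetric] period_def[symmetric] by blast+

lemma mark_free_code_iff:
  assumes S: "reentry_system S"
  shows "mark_free_code (system_code S) w \<longleftrightarrow> mark_free_cycle (system_code S) w"
proof -
  have "mark_free_code (system_code S) w \<longleftrightarrow> pfst w = transient S \<and> psnd w = period S \<and>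
      (\<forall>t<transient S + period S. \<not> behaviour S t)"
    unfolding mark_free_code_def returns_code_iff[OF S] behaviour_code_eq[OF S] dimension_code_eq
    using transient_period_unique[OF S, of "pfst w" "psnd w"] transient_period(1)[OF S]
      not_periodic_before by metis
  also have "\<dots> \<longleftrightarrow> mark_free_cycle (system_code S) w"
    using S by (auto simp: mark_free_cycle_def prod_encode_eq_iff)
  finally show ?thesis .
qed

lemma reentry_certificate_scheme: "certificate_scheme reentry_domain mark_free_cycle"
proof (rule certificate_schemeI[OF computable_mark_free_code])
  show "mark_free_cycle p w \<longleftrightarrow> mark_free_code p w" if "p \<in> distinctions reentry_domain" for p w
    using that mark_free_code_iff by (auto simp: reentry_distinctions)
  show "p \<notin> manifest reentry_domain \<longleftrightarrow> (\<exists>w. mark_free_cycle p w)"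
    if p: "p \<in> distinctions reentry_domain" for p
  proof -
    obtain S where S: "reentry_system S" "p = system_code S"
      using p unfolding reentry_distinctions by blast
    show ?thesis
      using S(1) system_manifests_iff[OF S(1) order_refl]
      unfolding S(2) reentry_manifest[OF S(1)] by (auto simp: mark_free_cycle_def)
  qed
qed

lemma computable_dimension_bound:
  "computable_on (distinctions reentry_domain) (\<lambda>p. Some (2 ^ dimension_code p))"
  by (rule computable_onI[of "\<lambda>p. 2 ^ dimension_code p"]) (intro computable_intro, simp)

text \<open>\<open>transient\<close> and \<open>period\<close> are those of the states; the observed
  coordinate inherits them, though its own least values may be smaller.\<close>

lemma periodic_behaviour:
  "periodic_from (evolution S) m k \<Longrightarrow> periodic_from (behaviour S) m k"
  by (auto simp: periodic_from_def behaviour_def)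

theorem proposition4p2:
  shows
    "(\<forall>D. decidable_domain D \<longrightarrow>
        total_adjudicator D (canonical_adjudicator D) \<and>
        computable_on (distinctions D) (canonical_adjudicator D) \<and>
        correct_adjudicator D (canonical_adjudicator D))
     \<and>
     ((\<forall>\<phi>. sentence \<phi> \<longrightarrow> (fm_code \<phi> \<in> manifest presburger_domain \<longleftrightarrow> true_in_nat \<phi>)) \<and>
      decidable_domain presburger_domain \<and>
      (\<forall>\<phi>. finite_dfa (free_vars \<phi>) (fm_dfa \<phi>) \<and>
           (\<forall>u \<in> lists (Pow (free_vars \<phi>)).
              dfa_accepts (fm_dfa \<phi>) u \<longleftrightarrow> sat (word_val u) \<phi>)) \<and>
      certifying_decision presburger_domain accepting_run rejecting_run \<and>
      certificate_scheme presburger_domain rejecting_run)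
     \<and>
     (decidable_domain reentry_domain \<and>
      (\<forall>S. reentry_system S \<longrightarrow>
         (system_code S \<in> manifest reentry_domain \<longleftrightarrow> system_manifests S) \<and>
         finite (state_space S) \<and> card (state_space S) \<le> 2 ^ dimension S \<and>
         (\<forall>t. evolution S t \<in> state_space S) \<and>
         (\<forall>t t'. evolution S t = evolution S t' \<longrightarrow>
                 evolution S (Suc t) = evolution S (Suc t')) \<and>
         periodic_from (evolution S) (transient S) (period S) \<and>
         periodic_from (behaviour S) (transient S) (period S) \<and>
         (system_code S \<notin> manifest reentry_domain \<longleftrightarrow>
            (\<forall>t < transient S + period S. \<not> behaviour S t)) \<and>
         transient S + period S \<le> 2 ^ dimension S) \<and>
      certificate_scheme reentry_domain mark_free_cycle \<and>
      (\<exists>B. computable_on (distinctions reentry_domain) (\<lambda>p. Some (B p)) \<and>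
           (\<forall>S. reentry_system S \<longrightarrow>
              B (system_code S) = 2 ^ dimension S \<and>
              transient S + period S \<le> B (system_code S))))"
proof (intro conjI allI impI)
  fix D assume "decidable_domain D"
  then show "computable_on (distinctions D) (canonical_adjudicator D)"
    by (rule canonical_adjudicator_computable)
  show "correct_adjudicator D (canonical_adjudicator D)"
    by (rule canonical_adjudicator_correct)
  then show "total_adjudicator D (canonical_adjudicator D)"
    by (simp add: correct_adjudicator_def)
next
  show "\<exists>B. computable_on (distinctions reentry_domain) (\<lambda>p. Some (B p)) \<and>
      (\<forall>S. reentry_system S \<longrightarrow> B (system_code S) = 2 ^ dimension S \<and>
        transient S + period S \<le> B (system_code S))"
    by (intro exI[of _ "\<lambda>p. 2 ^ dimension_code p"] conjI computable_dimension_bound)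
      (simp add: dimension_code_eq transient_period(2))
next
  fix S assume S: "reentry_system S"
  show "system_code S \<notin> manifest reentry_domain \<longleftrightarrow>
      (\<forall>t<transient S + period S. \<not> behaviour S t)"
    using reentry_manifest[OF S] system_manifests_iff[OF S order_refl] by blast
qed (simp_all only: presburger_codes(1) decidable_presburger finite_dfa_fm fm_dfa_accepts
    presburger_certifying_decision presburger_certificate_scheme decidable_reentry reentry_manifest
    finite_state_space card_state_space order_refl evolution_in_state_space evolution_Suc
    transient_period(1,2) periodic_behaviour reentry_certificate_scheme ball_triv simp_thms)

end
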